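(* Fix $1\leq p\leq\infty$. The rule $\|\cdot\|_{(p,1)}$, given by $\|T\|_{(p,1)}:=\|T\|_{\mathcal{L}(X,Y)}+C_{(p,1)}(T)$ for Banach spaces $X,Y$ and $T\in\mathcal{WD}_{\ell_p}^{(\infty,1)}(X,Y)$, is an ideal norm which makes the class $\mathcal{WD}_{\ell_p}^{(\infty,1)}$ into a Banach ideal.
   Context: All Banach spaces are over a fixed scalar field ($\mathbb{R}$ or $\mathbb{C}$); $\mathcal{L}(X,Y)$ is the space of continuous linear operators $X\to Y$ with the operator norm; $c_{00}$ is the space of finitely supported scalar sequences. First Schreier family: $\mathcal{S}_1:=\{F\subset\mathbb{N}:\#F\leq\min F\}\cup\{\emptyset\}$. Put $\mathcal{A}_1:=\{(\alpha_k)\in c_{00}:\mathrm{supp}(\alpha_k)\in\mathcal{S}_1\}$. For $0\leq C<\infty$, $\mathcal{WD}_{\ell_p}^{(C,1)}(X,Y)$ is the set of all $T\in\mathcal{L}(X,Y)$ such that for every $\epsilon>0$, each normalized weakly null sequence $(x_n)\subset X$ admits a subsequence $(x_{n_k})$ with $\|\sum\alpha_kTx_{n_k}\|\leq(C+\epsilon)\|(\alpha_k)\|_{\ell_p}$ for all $(\alpha_k)\in\mathcal{A}_1$. Set $\mathcal{WD}_{\ell_p}^{(\infty,1)}(X,Y):=\bigcup_{0\leq C<\infty}\mathcal{WD}_{\ell_p}^{(C,1)}(X,Y)$; the class $\mathcal{WD}_{\ell_p}^{(\infty,1)}$ has these sets as components. For $T\in\mathcal{WD}_{\ell_p}^{(\infty,1)}(X,Y)$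 define $C_{(p,1)}(T):=\inf\{0\leq C<\infty:T\in\mathcal{WD}_{\ell_p}^{(C,1)}(X,Y)\}$. Operator ideal: a subclass $\mathcal{J}$ of the class $\mathcal{L}$ of all continuous linear operators between Banach spaces such that, for all Banach spaces $X,Y$, $\mathcal{J}(X,Y):=\mathcal{L}(X,Y)\cap\mathcal{J}$ is a linear subspace containing all finite-rank operators from $X$ into $Y$, and such that $BTA\in\mathcal{J}(W,Z)$ whenever $W,X,Y,Z$ are Banach spaces, $T\in\mathcal{J}(X,Y)$, $A\in\mathcal{L}(W,X)$, $B\in\mathcal{L}(Y,Z)$. Ideal norm on an operator ideal $\mathcal{J}$: a rule $\rho$ assigning to every $T\in\mathcal{J}(X,Y)$ a nonnegative real $\rho(T)$ such that, for all Banach spaces $W,X,Y,Z$: (1) $\rho(x^*\otimes y)=\|x^*\|\|y\|$ for all $x^*\in X^*$, $y\in Y$, where $x^*\otimes y$ is the operator $x\mapsto x^*(x)y$; (2) $\rho(S+T)\leq\rho(S)+\rho(T)$ for all $S,T\in\mathcal{J}(X,Y)$; (3) $\rho(BTA)\leq\|B\|\rho(T)\|A\|$ for all $T\in\mathcal{J}(X,Y)$, $A\in\mathcal{L}(W,X)$, $B\in\mathcal{L}(Y,Z)$. Banach ideal: an operator ideal $\mathcal{J}$ equipped with an ideal norm $\rho$ such that every component $\mathcal{J}(X,Y)$ is complete with respect to the norm induced on it by $\rho$. *)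

theory Defs
  imports "HOL-Analysis.Analysis"
begin

text \<open>
  The scalar field is a type \<open>'k\<close> of class \<^class>\<open>real_normed_field\<close>. By the theorem of Mazur
  such a field is isometrically isomorphic to the reals or to the complex numbers, and both types
  are instances. A Banach space over \<open>'k\<close> is a type of class \<^class>\<open>banach\<close> together with a
  scalar multiplication by \<open>'k\<close> that is compatible with the norm and extends the real one.
\<close>

locale banach_space_over = vector_space scale
  for scale :: "'k::real_normed_field \<Rightarrow> 'x::banach \<Rightarrow> 'x" +
  assumes norm_scale: "norm (scale a x) = norm a * norm x"
    and scale_of_real: "scale (of_real r) x = r *\<^sub>R x"

lemma banach_space_over_real:
  "banach_space_over (scaleR :: real \<Rightarrow> 'x::banach \<Rightarrow> 'x)"
  by unfold_locales (auto simp: algebra_simps)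

lemma banach_space_over_complex:
  "banach_space_over ((*) :: complex \<Rightarrow> complex \<Rightarrow> complex)"
  by unfold_locales (auto simp: algebra_simps norm_mult scaleR_conv_of_real)

text \<open>
  Elements of \<^typ>\<open>'x \<Rightarrow>\<^sub>L 'y\<close> are continuous and real-linear; \<open>ops\<close> adds linearity over
  \<open>'k\<close>. The norm of \<^typ>\<open>'x \<Rightarrow>\<^sub>L 'y\<close> is the operator norm.
\<close>

definition ops ::
  "('k::real_normed_field \<Rightarrow> 'x::real_normed_vector \<Rightarrow> 'x) \<Rightarrow>
   ('k \<Rightarrow> 'y::real_normed_vector \<Rightarrow> 'y) \<Rightarrow> ('x \<Rightarrow>\<^sub>L 'y) set" where
  "ops sX sY = {T. \<forall>a x. blinfun_apply T (sX a x) = sY a (blinfun_apply T x)}"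

definition dual ::
  "('k::real_normed_field \<Rightarrow> 'x::real_normed_vector \<Rightarrow> 'x) \<Rightarrow> ('x \<Rightarrow>\<^sub>L 'k) set" where
  "dual sX = ops sX (*)"

definition scale_op ::
  "('k::real_normed_field \<Rightarrow> 'y::real_normed_vector \<Rightarrow> 'y) \<Rightarrow> 'k \<Rightarrow>
   ('x::real_normed_vector \<Rightarrow>\<^sub>L 'y) \<Rightarrow> ('x \<Rightarrow>\<^sub>L 'y)" where
  "scale_op sY a T = Blinfun (\<lambda>x. sY a (blinfun_apply T x))"

definition rank_one ::
  "('k::real_normed_field \<Rightarrow> 'y::real_normed_vector \<Rightarrow> 'y) \<Rightarrow>
   ('x::real_normed_vector \<Rightarrow>\<^sub>L 'k) \<Rightarrow> 'y \<Rightarrow> ('x \<Rightarrow>\<^sub>L 'y)" where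
  "rank_one sY f y = Blinfun (\<lambda>x. sY (blinfun_apply f x) y)"

definition finite_rank ::
  "('k::real_normed_field \<Rightarrow> 'y::real_normed_vector \<Rightarrow> 'y) \<Rightarrow>
   ('x::real_normed_vector \<Rightarrow>\<^sub>L 'y) \<Rightarrow> bool" where
  "finite_rank sY T \<longleftrightarrow>
     (\<exists>S. finite S \<and> range (blinfun_apply T) \<subseteq> module.span sY S)"

context banach_space_over
begin

lemma scale_of_real_mult: "scale (of_real r * a) x = r *\<^sub>R scale a x"
  using scale_of_real[of r "scale a x"] by (simp add: scale_scale)

lemma bounded_linear_scale_right: "bounded_linear (scale a)"
proof (rule bounded_linear_intro[where K = "norm a"])
  show "scale a (r *\<^sub>R x) = r *\<^sub>R scale a x" for r x
    by (metis scale_left_commute scale_of_real)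
qed (simp_all add: scale_right_distrib norm_scale mult.commute)

lemma bounded_linear_scale_left: "bounded_linear (\<lambda>a. scale a x)"
  by (rule bounded_linear_intro[where K = "norm x"])
     (simp_all add: scale_left_distrib norm_scale scale_of_real_mult scaleR_conv_of_real)

lemma scale_op_apply: "blinfun_apply (scale_op scale a T) x = scale a (blinfun_apply T x)"
  unfolding scale_op_def
  by (subst bounded_linear_Blinfun_apply)
     (auto intro!: bounded_linear_compose[OF bounded_linear_scale_right] blinfun.bounded_linear_right)

lemma rank_one_apply: "blinfun_apply (rank_one scale f y) x = scale (blinfun_apply f x) y"
  unfolding rank_one_def
  by (subst bounded_linear_Blinfun_apply)
     (auto intro!: bounded_linear_compose[OF bounded_linear_scale_left] blinfun.bounded_linear_right)

lemma module_scale_op: "module (scale_op scale :: 'k \<Rightarrow> ('c::real_normed_vector \<Rightarrow>\<^sub>L 'x) \<Rightarrow> _)"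
  by unfold_locales
     (auto intro!: blinfun_eqI
       simp: scale_op_apply blinfun.add_left scale_right_distrib scale_left_distrib)

end

definition normalized_weakly_null ::
  "('k::real_normed_field \<Rightarrow> 'x::real_normed_vector \<Rightarrow> 'x) \<Rightarrow> (nat \<Rightarrow> 'x) \<Rightarrow> bool" where
  "normalized_weakly_null sX x \<longleftrightarrow>
     (\<forall>n. norm (x n) = 1) \<and> (\<forall>f\<in>dual sX. (\<lambda>n. blinfun_apply f (x n)) \<longlonglongrightarrow> 0)"

definition schreier :: "nat set set" where
  "schreier = {F. finite F \<and> F \<noteq> {} \<and> F \<subseteq> {1..} \<and> card F \<le> Min F} \<union> {{}}"

text \<open>
  The Schreier family consists of sets of positive integers, whereas sequences of type
  \<^typ>\<open>nat \<Rightarrow> 'a\<close> start at index 0. The entry of a sequence at index \<open>k\<close> is therefore the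
  term number \<open>Suc k\<close>.
\<close>

definition schreier_seqs :: "(nat \<Rightarrow> 'k::real_normed_field) set" where
  "schreier_seqs = {\<alpha>. finite {k. \<alpha> k \<noteq> 0} \<and> Suc ` {k. \<alpha> k \<noteq> 0} \<in> schreier}"

text \<open>The norm of \<open>\<ell>\<^sub>p\<close>, used for finitely supported sequences only.\<close>

definition lp_norm :: "ereal \<Rightarrow> (nat \<Rightarrow> 'k::real_normed_field) \<Rightarrow> real" where
  "lp_norm p \<alpha> =
     (if p = \<infinity> then (SUP k. norm (\<alpha> k))
      else (\<Sum>k | \<alpha> k \<noteq> 0. norm (\<alpha> k) powr real_of_ereal p) powr (1 / real_of_ereal p))"

definition WD ::
  "ereal \<Rightarrow> real \<Rightarrow> ('k::real_normed_field \<Rightarrow> 'x::real_normed_vector \<Rightarrow> 'x) \<Rightarrow>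
   ('k \<Rightarrow> 'y::real_normed_vector \<Rightarrow> 'y) \<Rightarrow> ('x \<Rightarrow>\<^sub>L 'y) set" where
  "WD p C sX sY =
     {T \<in> ops sX sY. \<forall>\<epsilon>>0. \<forall>x. normalized_weakly_null sX x \<longrightarrow>
        (\<exists>n::nat \<Rightarrow> nat. strict_mono n \<and>
          (\<forall>\<alpha>\<in>schreier_seqs.
             norm (\<Sum>k | \<alpha> k \<noteq> 0. sY (\<alpha> k) (blinfun_apply T (x (n k)))) \<le> (C + \<epsilon>) * lp_norm p \<alpha>))}"

definition WD_inf ::
  "ereal \<Rightarrow> ('k::real_normed_field \<Rightarrow> 'x::real_normed_vector \<Rightarrow> 'x) \<Rightarrow>
   ('k \<Rightarrow> 'y::real_normed_vector \<Rightarrow> 'y) \<Rightarrow> ('x \<Rightarrow>\<^sub>L 'y) set" where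
  "WD_inf p sX sY = (\<Union>C\<in>{0..}. WD p C sX sY)"

definition WD_const ::
  "ereal \<Rightarrow> ('k::real_normed_field \<Rightarrow> 'x::real_normed_vector \<Rightarrow> 'x) \<Rightarrow>
   ('k \<Rightarrow> 'y::real_normed_vector \<Rightarrow> 'y) \<Rightarrow> ('x \<Rightarrow>\<^sub>L 'y) \<Rightarrow> real" where
  "WD_const p sX sY T = Inf {C. 0 \<le> C \<and> T \<in> WD p C sX sY}"

definition WD_norm ::
  "ereal \<Rightarrow> ('k::real_normed_field \<Rightarrow> 'x::real_normed_vector \<Rightarrow> 'x) \<Rightarrow>
   ('k \<Rightarrow> 'y::real_normed_vector \<Rightarrow> 'y) \<Rightarrow> ('x \<Rightarrow>\<^sub>L 'y) \<Rightarrow> real" where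
  "WD_norm p sX sY T = norm T + WD_const p sX sY T"

text \<open>
  A class of operators between arbitrary Banach spaces is a family of sets indexed by types, which
  is not an object of the logic. The following predicates therefore state the axioms for given
  Banach spaces \<open>W, X, Y, Z\<close> and the components of the class (and of the norm) that the
  axioms mention, namely those at \<open>(X, Y)\<close> and at \<open>(W, Z)\<close>. The class is an operator ideal,
  resp. a Banach ideal, iff the predicate holds for all types and scalar multiplications
  \<open>W, X, Y, Z\<close>.
\<close>

definition operator_ideal ::
  "('k::real_normed_field \<Rightarrow> 'w::banach \<Rightarrow> 'w) \<Rightarrow> ('k \<Rightarrow> 'x::banach \<Rightarrow> 'x) \<Rightarrow>
   ('k \<Rightarrow> 'y::banach \<Rightarrow> 'y) \<Rightarrow> ('k \<Rightarrow> 'z::banach \<Rightarrow> 'z) \<Rightarrow>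
   ('x \<Rightarrow>\<^sub>L 'y) set \<Rightarrow> ('w \<Rightarrow>\<^sub>L 'z) set \<Rightarrow> bool" where
  "operator_ideal sW sX sY sZ J_XY J_WZ \<longleftrightarrow>
     J_XY \<subseteq> ops sX sY \<and>
     module.subspace (scale_op sY) J_XY \<and>
     (\<forall>T\<in>ops sX sY. finite_rank sY T \<longrightarrow> T \<in> J_XY) \<and>
     (\<forall>T\<in>J_XY. \<forall>A\<in>ops sW sX. \<forall>B\<in>ops sY sZ. B o\<^sub>L T o\<^sub>L A \<in> J_WZ)"

definition ideal_norm ::
  "('k::real_normed_field \<Rightarrow> 'w::banach \<Rightarrow> 'w) \<Rightarrow> ('k \<Rightarrow> 'x::banach \<Rightarrow> 'x) \<Rightarrow>
   ('k \<Rightarrow> 'y::banach \<Rightarrow> 'y) \<Rightarrow> ('k \<Rightarrow> 'z::banach \<Rightarrow> 'z) \<Rightarrow>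
   ('x \<Rightarrow>\<^sub>L 'y) set \<Rightarrow> (('x \<Rightarrow>\<^sub>L 'y) \<Rightarrow> real) \<Rightarrow> (('w \<Rightarrow>\<^sub>L 'z) \<Rightarrow> real) \<Rightarrow> bool" where
  "ideal_norm sW sX sY sZ J_XY \<rho>_XY \<rho>_WZ \<longleftrightarrow>
     (\<forall>T\<in>J_XY. 0 \<le> \<rho>_XY T) \<and>
     (\<forall>f\<in>dual sX. \<forall>y. \<rho>_XY (rank_one sY f y) = norm f * norm y) \<and>
     (\<forall>S\<in>J_XY. \<forall>T\<in>J_XY. \<rho>_XY (S + T) \<le> \<rho>_XY S + \<rho>_XY T) \<and>
     (\<forall>T\<in>J_XY. \<forall>A\<in>ops sW sX. \<forall>B\<in>ops sY sZ.
        \<rho>_WZ (B o\<^sub>L T o\<^sub>L A) \<le> norm B * \<rho>_XY T * norm A)"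

definition complete_wrt :: "('a::ab_group_add) set \<Rightarrow> ('a \<Rightarrow> real) \<Rightarrow> bool" where
  "complete_wrt J \<rho> \<longleftrightarrow>
     (\<forall>\<sigma>::nat \<Rightarrow> 'a. (\<forall>n. \<sigma> n \<in> J) \<longrightarrow>
        (\<forall>\<epsilon>>0. \<exists>N. \<forall>m\<ge>N. \<forall>n\<ge>N. \<rho> (\<sigma> m - \<sigma> n) < \<epsilon>) \<longrightarrow>
        (\<exists>T\<in>J. (\<lambda>n. \<rho> (\<sigma> n - T)) \<longlonglongrightarrow> 0))"

definition banach_ideal ::
  "('k::real_normed_field \<Rightarrow> 'w::banach \<Rightarrow> 'w) \<Rightarrow> ('k \<Rightarrow> 'x::banach \<Rightarrow> 'x) \<Rightarrow>
   ('k \<Rightarrow> 'y::banach \<Rightarrow> 'y) \<Rightarrow> ('k \<Rightarrow> 'z::banach \<Rightarrow> 'z) \<Rightarrow>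
   ('x \<Rightarrow>\<^sub>L 'y) set \<Rightarrow> ('w \<Rightarrow>\<^sub>L 'z) set \<Rightarrow>
   (('x \<Rightarrow>\<^sub>L 'y) \<Rightarrow> real) \<Rightarrow> (('w \<Rightarrow>\<^sub>L 'z) \<Rightarrow> real) \<Rightarrow> bool" where
  "banach_ideal sW sX sY sZ J_XY J_WZ \<rho>_XY \<rho>_WZ \<longleftrightarrow>
     operator_ideal sW sX sY sZ J_XY J_WZ \<and>
     ideal_norm sW sX sY sZ J_XY \<rho>_XY \<rho>_WZ \<and>
     complete_wrt J_XY \<rho>_XY"

end

theory Submission
  imports Defs "HOL-Library.Diagonal_Subsequence"
begin

text \<open>
  Everything rests on three features of estimates over Schreier sets. The Schreier family is spreading,
  so an estimate passes to subsequences; hence subsequences for two operators can be chosen one after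
  the other, and sums and the triangle inequality follow. Schreier sets \<open>F\<close> satisfy \<open>card F \<le> min F\<close>, so an
  error of order \<open>1 / k\<close> at position \<open>k\<close> is harmless (\<open>norm_schreier_sum_le\<close>); in particular a sequence
  tending to 0 in norm has, for every \<open>\<epsilon>\<close>, a subsequence satisfying the estimate with constant \<open>\<epsilon>\<close>.
  Finally, the estimate is compatible with multiplying coefficients by bounded scalars, so it extends to
  bounded weakly null sequences (\<open>WD_bounded_weakly_null\<close>), which is what the ideal property needs: the
  image of a normalized weakly null sequence is weakly null but no longer normalized.

  Completeness comes down to each class with a fixed constant being closed in the operator norm
  (\<open>WD_closed\<close>). Given approximating operators, a diagonal subsequence serves all of them, the
  \<open>k\<close>-th from position \<open>k\<close> on; for a Schreier set with minimum \<open>l\<close> one uses the \<open>l\<close>-th approximation, whose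
  error may be of order \<open>1 / l\<close>.

  A finite-rank operator maps weakly null sequences to null sequences, which makes its constant 0 and
  gives the value of the norm at rank-one operators. The mathematical content here is the continuity
  of the coordinates on a finite-dimensional space, and it needs a complete scalar field. The scalars
  form an arbitrary field with a multiplicative norm over the reals; such a field is complete by
  Mazur's theorem (\<open>real_normed_field_real_basis\<close>), which is proved by minimizing the norm of monic real
  quadratics in a given element.
\<close>

section \<open>Real normed fields are finite-dimensional over the reals\<close>

text \<open>
  Writing \<open>q x = x\<^sup>2 + s x + t\<close>, the left-hand side is \<open>\<bar>q x - z\<bar>\<^sup>2\<close> at real \<open>x\<close>. The complex quadratic
  \<open>q - z\<close> has two roots \<open>w\<^sub>1, w\<^sub>2\<close>, hence \<open>\<bar>q x - z\<bar>\<^sup>2 = \<bar>x - w\<^sub>1\<bar>\<^sup>2 \<bar>x - w\<^sub>2\<bar>\<^sup>2\<close>, and each factor is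
  a real quadratic in \<open>x\<close>. As an identity of real polynomials, it holds in every real algebra.
\<close>

lemma quartic_eq_quadratic_times_quadratic:
  fixes z :: complex
  obtains s1 t1 s2 t2 :: real
  where "\<And>x::'k::real_normed_field.
    (x\<^sup>2 + of_real s * x + of_real t)\<^sup>2 - of_real (2 * Re z) * (x\<^sup>2 + of_real s * x + of_real t)
      + of_real ((cmod z)\<^sup>2)
    = (x\<^sup>2 + of_real s1 * x + of_real t1) * (x\<^sup>2 + of_real s2 * x + of_real t2)"
proof -
  define h where "h = s / 2"
  define D where "D = csqrt (of_real (h\<^sup>2 - t) + z)"
  define u v where "u = Re D" and "v = Im D"
  have "D\<^sup>2 = of_real (h\<^sup>2 - t) + z" by (simp add: D_def)
  hence Re: "Re z = u\<^sup>2 - v\<^sup>2 - h\<^sup>2 + t" and Im: "Im z = 2 * u * v"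
    by (auto simp: u_def v_def complex_eq_iff Re_power2 Im_power2)
  have n: "(cmod z)\<^sup>2 = (u\<^sup>2 - v\<^sup>2 - h\<^sup>2 + t)\<^sup>2 + 4 * u\<^sup>2 * v\<^sup>2"
    by (simp add: cmod_power2 Re Im power_mult_distrib)
  have s: "s = 2 * h" by (simp add: h_def)
  show thesis
  proof (rule that[of "2 * h - 2 * u" "(u - h)\<^sup>2 + v\<^sup>2" "2 * h + 2 * u" "(u + h)\<^sup>2 + v\<^sup>2"])
    fix x :: 'k
    define U V H T where "U = (of_real u :: 'k)" and "V = (of_real v :: 'k)"
      and "H = (of_real h :: 'k)" and "T = (of_real t :: 'k)"
    show "(x\<^sup>2 + of_real s * x + of_real t)\<^sup>2 - of_real (2 * Re z) * (x\<^sup>2 + of_real s * x + of_real t)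
      + of_real ((cmod z)\<^sup>2) = (x\<^sup>2 + of_real (2 * h - 2 * u) * x + of_real ((u - h)\<^sup>2 + v\<^sup>2)) *
         (x\<^sup>2 + of_real (2 * h + 2 * u) * x + of_real ((u + h)\<^sup>2 + v\<^sup>2))"
      unfolding n Re s of_real_add of_real_diff of_real_mult of_real_power of_real_numeral
        U_def[symmetric] V_def[symmetric] H_def[symmetric] T_def[symmetric]
      by (simp add: power2_eq_square algebra_simps)
  qed
qed

text \<open>
  The setting is a field element \<open>a\<close> at which the norms of all monic real quadratics are at least
  \<open>m > 0\<close>; \<open>Q\<close> is the value of one of them. A polynomial in \<open>Q\<close> that splits into \<open>n\<close> real quadratics in
  \<open>a\<close> then has norm at least \<open>m ^ n\<close>, because the norm is multiplicative. Exponents are powers of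
  two so that square roots are the only roots that have to be extracted.
\<close>

context
  fixes a :: "'k::real_normed_field" and s t m :: real and Q :: 'k
  assumes low: "\<And>s t. m \<le> norm (a\<^sup>2 + of_real s * a + of_real t)"
    and m: "0 < m"
    and Q: "Q = a\<^sup>2 + of_real s * a + of_real t"
begin

text \<open>
  The element is \<open>\<bar>Q ^ N - z\<bar>\<^sup>2\<close> with \<open>N = 2 ^ j\<close>, read as a real polynomial in \<open>Q\<close>. For \<open>w\<^sup>2 = z\<close> it
  is the product of \<open>\<bar>Q ^ (N/2) - w\<bar>\<^sup>2\<close> and \<open>\<bar>Q ^ (N/2) + w\<bar>\<^sup>2\<close>, so that induction reduces the claim to
  the quartic case.
\<close>

lemma norm_conj_pair_ge:
  "m ^ (2 * 2 ^ j) \<le> norm (Q ^ (2 * 2 ^ j) - of_real (2 * Re z) * Q ^ 2 ^ j + of_real ((cmod z)\<^sup>2))"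
proof (induction j arbitrary: z)
  case 0
  obtain s1 t1 s2 t2 where
    "Q\<^sup>2 - of_real (2 * Re z) * Q + of_real ((cmod z)\<^sup>2)
      = (a\<^sup>2 + of_real s1 * a + of_real t1) * (a\<^sup>2 + of_real s2 * a + of_real t2)"
    unfolding Q using quartic_eq_quadratic_times_quadratic[where ?'k = 'k] by metis
  then show ?case
    using mult_mono[OF low[of s1 t1] low[of s2 t2]] m by (simp add: norm_mult power2_eq_square)
next
  case (Suc j)
  define w where "w = csqrt z"
  define Y where "Y = Q ^ 2 ^ j"
  define U V where "U = (of_real (Re w) :: 'k)" and "V = (of_real (Im w) :: 'k)"
  have "z = w\<^sup>2" by (simp add: w_def)
  hence z: "Re z = (Re w)\<^sup>2 - (Im w)\<^sup>2" "(cmod z)\<^sup>2 = ((Re w)\<^sup>2 + (Im w)\<^sup>2)\<^sup>2"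
    by (simp_all add: Re_power2 norm_power cmod_power2)
  have "Q ^ (2 * 2 ^ Suc j) - of_real (2 * Re z) * Q ^ 2 ^ Suc j + of_real ((cmod z)\<^sup>2)
      = (Y\<^sup>2)\<^sup>2 - of_real (2 * Re z) * Y\<^sup>2 + of_real ((cmod z)\<^sup>2)"
    by (simp add: Y_def power_mult [symmetric] mult_ac)
  also have "\<dots> = (Y\<^sup>2 - of_real (2 * Re w) * Y + of_real ((cmod w)\<^sup>2))
      * (Y\<^sup>2 - of_real (2 * Re (- w)) * Y + of_real ((cmod (- w))\<^sup>2))"
    unfolding z unfolding norm_minus_cancel cmod_power2 of_real_add of_real_diff of_real_mult of_real_power
      of_real_numeral uminus_complex.simps of_real_minus U_def[symmetric] V_def[symmetric]
    by (simp add: power2_eq_square algebra_simps)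
  finally have eq: "Q ^ (2 * 2 ^ Suc j) - of_real (2 * Re z) * Q ^ 2 ^ Suc j + of_real ((cmod z)\<^sup>2)
    = (Q ^ (2 * 2 ^ j) - of_real (2 * Re w) * Q ^ 2 ^ j + of_real ((cmod w)\<^sup>2))
      * (Q ^ (2 * 2 ^ j) - of_real (2 * Re (- w)) * Q ^ 2 ^ j + of_real ((cmod (- w))\<^sup>2))"
    by (simp add: Y_def power_mult [symmetric] mult_ac)
  have "m ^ (2 * 2 ^ Suc j) = m ^ (2 * 2 ^ j) * m ^ (2 * 2 ^ j)"
    by (simp flip: power_add)
  also have "\<dots> \<le> norm (Q ^ (2 * 2 ^ Suc j) - of_real (2 * Re z) * Q ^ 2 ^ Suc j + of_real ((cmod z)\<^sup>2))"
    unfolding eq norm_mult by (rule mult_mono[OF Suc.IH Suc.IH]) (use m in auto)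
  finally show ?case .
qed

lemma norm_power_plus_ge: "m ^ 2 ^ j \<le> norm (Q ^ 2 ^ j + of_real c ^ 2 ^ j)"
proof (cases j)
  case 0
  then show ?thesis using low[of s "t + c"] by (simp add: Q algebra_simps)
next
  case (Suc i)
  \<comment> \<open>the conjugate pair for a purely imaginary \<open>z\<close>, where the middle term vanishes\<close>
  have "m ^ 2 ^ j \<le> norm (Q ^ 2 ^ j + of_real ((cmod (\<i> * of_real (c ^ 2 ^ i)))\<^sup>2))"
    using norm_conj_pair_ge[of i "\<i> * of_real (c ^ 2 ^ i)"] by (simp add: Suc)
  also have "(cmod (\<i> * of_real (c ^ 2 ^ i)))\<^sup>2 = c ^ 2 ^ j"
    by (simp add: Suc norm_mult norm_power power_even_abs mult.commute flip: power_mult)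
  finally show ?thesis by simp
qed

text \<open>
  The telescoping factorization
  \<open>Q ^ 2 ^ j - c ^ 2 ^ j = (Q - c) (Q + c) (Q\<^sup>2 + c\<^sup>2) (Q ^ 4 + c ^ 4) \<dots>\<close>, in which all factors but
  the first are bounded below by the preceding lemma.
\<close>

lemma norm_minus_real_le:
  "norm (Q - of_real c) * m ^ 2 ^ j \<le> m * norm (Q ^ 2 ^ j - of_real c ^ 2 ^ j)"
proof (induction j)
  case (Suc j)
  have "norm (Q - of_real c) * m ^ 2 ^ Suc j = norm (Q - of_real c) * m ^ 2 ^ j * m ^ 2 ^ j"
    by (simp add: mult_2 power_add)
  also have "\<dots> \<le> m * norm (Q ^ 2 ^ j - of_real c ^ 2 ^ j) * norm (Q ^ 2 ^ j + of_real c ^ 2 ^ j)"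
    by (rule mult_mono[OF Suc.IH norm_power_plus_ge]) (use m in auto)
  also have "\<dots> = m * norm ((Q ^ 2 ^ j - of_real c ^ 2 ^ j) * (Q ^ 2 ^ j + of_real c ^ 2 ^ j))"
    by (simp add: norm_mult)
  also have "(Q ^ 2 ^ j - of_real c ^ 2 ^ j) * (Q ^ 2 ^ j + of_real c ^ 2 ^ j)
      = Q ^ 2 ^ Suc j - of_real c ^ 2 ^ Suc j"
    by (simp add: mult_2 power_add algebra_simps)
  finally show ?case .
qed simp

text \<open>
  If \<open>Q\<close> attains the minimal norm \<open>m\<close>, then so does every \<open>Q - c\<close> with \<open>\<bar>c\<bar> < m\<close>: dividing the preceding
  estimate by \<open>m ^ 2 ^ j\<close> bounds \<open>norm (Q - c)\<close> by \<open>m * (1 + (\<bar>c\<bar> / m) ^ 2 ^ j)\<close>, which tends to \<open>m\<close>.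
\<close>

lemma norm_minus_real_eq:
  assumes "norm Q = m" "\<bar>c\<bar> < m"
  shows "norm (Q - of_real c) = m"
proof (rule antisym)
  have le: "norm (Q - of_real c) \<le> m * (1 + (\<bar>c\<bar> / m) ^ 2 ^ j)" for j
  proof -
    have "norm (Q - of_real c) * m ^ 2 ^ j \<le> m * norm (Q ^ 2 ^ j - of_real c ^ 2 ^ j)"
      by (rule norm_minus_real_le)
    also have "norm (Q ^ 2 ^ j - of_real c ^ 2 ^ j) \<le> m ^ 2 ^ j + \<bar>c\<bar> ^ 2 ^ j"
      using norm_triangle_ineq4[of "Q ^ 2 ^ j" "of_real c ^ 2 ^ j"] by (simp add: norm_power assms)
    finally show ?thesis using m by (simp add: field_simps)
  qed
  have "(\<lambda>n. (\<bar>c\<bar> / m) ^ n) \<longlonglongrightarrow> 0"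
    using assms m by (intro LIMSEQ_power_zero) auto
  from LIMSEQ_subseq_LIMSEQ[OF this, of "\<lambda>j. 2 ^ j"]
  have "(\<lambda>j. (\<bar>c\<bar> / m) ^ 2 ^ j) \<longlonglongrightarrow> 0"
    by (simp add: strict_mono_def comp_def)
  hence "(\<lambda>j. m * (1 + (\<bar>c\<bar> / m) ^ 2 ^ j)) \<longlonglongrightarrow> m * (1 + 0)"
    by (intro tendsto_intros)
  from LIMSEQ_le_const[OF this] le show "norm (Q - of_real c) \<le> m" by auto
  show "m \<le> norm (Q - of_real c)"
    using low[of s "t - c"] by (simp add: Q algebra_simps)
qed

end

text \<open>
  For \<open>a\<close> not real, the norm of \<open>a\<^sup>2 + s a + t\<close> tends to infinity with \<open>(s, t)\<close> and so attains a minimum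
  \<open>m\<close>. If \<open>m\<close> were positive, the minimizer could be shifted by \<open>m / 2\<close> arbitrarily often without
  changing its norm, although real multiples of 1 have unbounded norm.
\<close>

lemma real_quadratic_root:
  fixes a :: "'k::real_normed_field"
  obtains s t :: real where "a\<^sup>2 + of_real s * a + of_real t = 0"
proof (cases "a \<in> \<real>")
  case True
  then obtain r where "a = of_real r" by (auto elim: Reals_cases)
  then show ?thesis by (intro that[of "- r" 0]) (simp add: power2_eq_square)
next
  case False
  let ?f = "\<lambda>(s::real, t::real). norm (a\<^sup>2 + of_real s * a + of_real t)"
  have "\<exists>r\<in>{-(2*norm a)..2*norm a}. \<forall>r'\<in>{-(2*norm a)..2*norm a}. norm (a + of_real r) \<le> norm (a + of_real r')"
    by (rule continuous_attains_inf) (auto intro!: continuous_intros)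
  then obtain r where r: "\<And>r'. \<bar>r'\<bar> \<le> 2 * norm a \<Longrightarrow> norm (a + of_real r) \<le> norm (a + of_real r')"
    by (metis abs_le_iff atLeastAtMost_iff minus_le_iff)
  define d where "d = norm (a + of_real r)"
  have "a + of_real r \<noteq> 0"
    using False by (metis Reals_of_real add_eq_0_iff2 Reals_minus_iff)
  hence d0: "0 < d" by (simp add: d_def)
  have d: "d \<le> norm (a + of_real r')" for r'
  proof (cases "\<bar>r'\<bar> \<le> 2 * norm a")
    case False
    have "d \<le> norm a" using r[of 0] by (simp add: d_def)
    also have "\<dots> \<le> norm (of_real r' :: 'k) - norm a" using False by simp
    also have "\<dots> \<le> norm (a + of_real r')"
      by (metis add.commute norm_diff_ineq)
    finally show ?thesis .
  qed (use r d_def in auto)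
  have ds: "\<bar>s\<bar> * d \<le> norm (of_real s * a + of_real t)" for s t
  proof (cases "s = 0")
    case False
    have "\<bar>s\<bar> * d \<le> \<bar>s\<bar> * norm (a + of_real (t / s))" by (intro mult_left_mono d) auto
    also have "\<dots> = norm (of_real s * (a + of_real (t / s)))" by (simp only: norm_mult norm_of_real)
    also have "of_real s * (a + of_real (t / s)) = of_real s * a + of_real t"
      using False by (simp add: algebra_simps)
    finally show ?thesis .
  qed simp
  \<comment> \<open>Outside the box of radius \<open>R\<close> the quadratic has norm at least \<open>2 * (norm a)\<^sup>2\<close>, which exceeds its
    norm at \<open>s = t = 0\<close>; the minimum over the box is therefore global.\<close>
  define K where "K = 3 * (norm a)\<^sup>2"
  define R where "R = K / d * (norm a + 1) + K"
  have K0: "0 \<le> K" by (simp add: K_def)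
  have small: "\<bar>s\<bar> \<le> R \<and> \<bar>t\<bar> \<le> R" if "norm (of_real s * a + of_real t) \<le> K" for s t
  proof -
    have s: "\<bar>s\<bar> \<le> K / d" using ds[of s t] that d0 by (simp add: field_simps)
    have "\<bar>t\<bar> = norm ((of_real s * a + of_real t) - of_real s * a :: 'k)" by simp
    also have "\<dots> \<le> K + \<bar>s\<bar> * norm a"
      using norm_triangle_ineq4[of "of_real s * a + of_real t" "of_real s * a"] that
      by (simp add: norm_mult)
    also have "\<dots> \<le> K + K / d * norm a" by (intro add_left_mono mult_right_mono s) auto
    also have "\<dots> \<le> R" using K0 d0 by (simp add: R_def algebra_simps)
    finally have "\<bar>t\<bar> \<le> R" .
    moreover have "K / d \<le> R"
      using K0 d0 by (simp add: R_def algebra_simps)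
    ultimately show ?thesis using s by linarith
  qed
  have R0: "0 \<le> R" using K0 d0 by (simp add: R_def)
  have "\<exists>x\<in>{-R..R}\<times>{-R..R}. \<forall>y\<in>{-R..R}\<times>{-R..R}. ?f x \<le> ?f y"
    by (rule continuous_attains_inf)
       (use R0 in \<open>auto intro!: continuous_intros compact_Times simp: case_prod_unfold\<close>)
  then obtain s t where st: "\<And>s' t'. \<bar>s'\<bar> \<le> R \<Longrightarrow> \<bar>t'\<bar> \<le> R \<Longrightarrow> ?f (s, t) \<le> ?f (s', t')"
    by (fastforce simp: abs_le_iff)
  define Q where "Q = a\<^sup>2 + of_real s * a + of_real t"
  define m where "m = norm Q"
  have low: "m \<le> norm (a\<^sup>2 + of_real s' * a + of_real t')" for s' t'
  proof (cases "norm (of_real s' * a + of_real t') \<le> K")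
    case True
    then show ?thesis using st small by (auto simp: m_def Q_def)
  next
    case False
    have "m \<le> norm (a\<^sup>2)" using st[of 0 0] R0 by (simp add: m_def Q_def)
    also have "\<dots> \<le> norm (of_real s' * a + of_real t') - norm (a\<^sup>2)"
      using False zero_le_power2[of "norm a"] unfolding K_def norm_power by linarith
    also have "\<dots> \<le> norm (a\<^sup>2 + of_real s' * a + of_real t')"
      using norm_diff_ineq[of "of_real s' * a + of_real t'" "a\<^sup>2"] by (simp add: add_ac)
    finally show ?thesis .
  qed
  have "m = 0"
  proof (rule ccontr)
    assume "m \<noteq> 0"
    hence m: "0 < m" by (simp add: m_def)
    have shift: "norm (Q - of_real (real k * (m / 2))) = m" for k
    proof (induction k)
      case (Suc k)
      have "norm (Q - of_real (real k * (m / 2)) - of_real (m / 2)) = m"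
        by (rule norm_minus_real_eq[OF low m, where s = s and t = "t - real k * (m / 2)"])
           (use Suc m in \<open>auto simp: Q_def algebra_simps\<close>)
      then show ?case by (simp add: algebra_simps add_divide_distrib)
    qed (simp add: m_def)
    \<comment> \<open>After five steps the shift \<open>5 m / 2\<close> exceeds the distance \<open>2 m\<close> that two elements of norm \<open>m\<close>
      can have.\<close>
    have "real 5 * (m / 2) = norm (of_real (real 5 * (m / 2)) :: 'k)" using m by simp
    also have "\<dots> = norm (Q - (Q - of_real (real 5 * (m / 2))))" by simp
    also have "\<dots> \<le> norm Q + norm (Q - of_real (real 5 * (m / 2)))" by (rule norm_triangle_ineq4)
    also have "\<dots> = 2 * m" unfolding shift by (simp add: m_def)
    finally show False using m by simp
  qed
  then show ?thesis using that[of s t] by (simp add: m_def Q_def)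
qed

text \<open>
  Mazur's theorem, in the form that the field has dimension at most two over the reals. Completing
  the square turns the quadratic equation of any element into \<open>(a + s)\<^sup>2 = d\<close> with real \<open>d\<close>; an element
  that is not real has \<open>d < 0\<close> and yields a square root \<open>j\<close> of \<open>-1\<close>, and all other elements are then
  real combinations of 1 and \<open>j\<close>.
\<close>

lemma real_normed_field_real_basis:
  obtains j :: "'k::real_normed_field" where "\<And>a::'k. \<exists>s t::real. a = of_real s + of_real t * j"
proof (cases "\<forall>a::'k. a \<in> \<real>")
  case True
  have "\<exists>s t::real. a = of_real s + of_real t * 0" for a :: 'k
    using True by (auto elim: Reals_cases)
  then show ?thesis using that by blast
next
  case False
  have square: "\<exists>s d::real. (a + of_real s)\<^sup>2 = of_real d" for a :: 'k
  proof -
    obtain s t where "a\<^sup>2 + of_real s * a + of_real t = 0" by (rule real_quadratic_root)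
    hence "(a + of_real (s / 2))\<^sup>2 = of_real ((s / 2)\<^sup>2 - t)"
      by (simp add: power2_sum algebra_simps add_eq_0_iff)
    then show ?thesis by blast
  qed
  have real_case: "a \<in> \<real>" if "(a + of_real s)\<^sup>2 = of_real d" "0 \<le> d" for a :: 'k and s d
  proof -
    have "(a + of_real s)\<^sup>2 = (of_real (sqrt d))\<^sup>2" using that by (simp flip: of_real_power)
    hence "a = of_real (sqrt d - s) \<or> a = of_real (- sqrt d - s)"
      by (auto simp: power2_eq_iff algebra_simps)
    then show ?thesis by auto
  qed
  from False obtain b :: 'k where b: "b \<notin> \<real>" by blast
  obtain s d where sd: "(b + of_real s)\<^sup>2 = of_real d" using square by blast
  hence d: "d < 0" using real_case b by force
  define j where "j = (b + of_real s) / of_real (sqrt (- d))"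
  have j: "j\<^sup>2 = - 1"
    using d sd by (simp add: j_def power_divide flip: of_real_power)
  have "\<exists>s t. a = of_real s + of_real t * j" for a
  proof -
    obtain s d where sd: "(a + of_real s)\<^sup>2 = of_real d" using square by blast
    show ?thesis
    proof (cases "0 \<le> d")
      case True
      then obtain r where "a = of_real r" using real_case sd by (metis Reals_cases)
      then have "a = of_real r + of_real 0 * j" by simp
      then show ?thesis by blast
    next
      case False
      hence "(a + of_real s)\<^sup>2 = (of_real (sqrt (- d)) * j)\<^sup>2"
        using sd j by (simp add: power_mult_distrib flip: of_real_power)
      hence "a + of_real s = of_real (sqrt (- d)) * j \<or> a + of_real s = of_real (- sqrt (- d)) * j"
        by (simp add: power2_eq_iff)
      then obtain r where "a + of_real s = of_real r * j" by blast
      hence "a = of_real (- s) + of_real r * j" by (simp add: algebra_simps)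
      then show ?thesis by blast
    qed
  qed
  then show ?thesis using that by blast
qed

section \<open>Finite-dimensional spaces and operators of finite rank\<close>

text \<open>
  The norm is not required to be complete, so that the locale also covers a normed field as a vector
  space over the reals.
\<close>

locale normed_space_over = vector_space scale
  for scale :: "'k::real_normed_field \<Rightarrow> 'x::real_normed_vector \<Rightarrow> 'x" +
  assumes norm_scale: "norm (scale a x) = norm a * norm x"
begin

lemma tendsto_scale:
  assumes "(f \<longlongrightarrow> a) F"
  shows "((\<lambda>n. scale (f n) x) \<longlongrightarrow> scale a x) F"
proof -
  have "((\<lambda>n. norm (f n - a) * norm x) \<longlongrightarrow> 0 * norm x) F"
    using assms by (intro tendsto_intros) (simp add: LIM_zero tendsto_norm_zero)
  hence "((\<lambda>n. norm (scale (f n) x - scale a x)) \<longlongrightarrow> 0) F"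
    by (simp add: norm_scale flip: scale_left_diff_distrib)
  then show ?thesis by (rule LIM_zero_cancel[OF tendsto_norm_zero_cancel])
qed

lemma complete_span_of_bounded_coordinates:
  assumes complete: "\<And>f::nat \<Rightarrow> 'k. Cauchy f \<Longrightarrow> convergent f"
    and B: "finite B"
    and M: "\<forall>c. \<forall>b\<in>B. norm (c b) \<le> M * norm (\<Sum>b\<in>B. scale (c b) b)"
    and v: "Cauchy v" "range v \<subseteq> span B"
  shows "\<exists>w\<in>span B. v \<longlonglongrightarrow> w"
  proof -
    have "\<exists>c. v n = (\<Sum>b\<in>B. scale (c b) b)" for n
    proof -
      have "v n \<in> span B" using v(2) by auto
      then show ?thesis unfolding span_finite[OF B(1)] by auto
    qed
    then obtain c where c: "\<And>n. v n = (\<Sum>b\<in>B. scale (c n b) b)" by metis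
    have "\<exists>l. (\<lambda>n. c n b) \<longlonglongrightarrow> l" if b: "b \<in> B" for b
    proof -
      have "Cauchy (\<lambda>n. c n b)"
      proof (rule CauchyI)
        fix e :: real assume e: "0 < e"
        define K where "K = \<bar>M\<bar> + 1"
        have K: "0 < K" "M \<le> K" by (simp_all add: K_def)
        from e K(1) have "0 < e / K" by (rule divide_pos_pos)
        from CauchyD[OF v(1) this] obtain N
          where N: "\<And>m n. m \<ge> N \<Longrightarrow> n \<ge> N \<Longrightarrow> norm (v m - v n) < e / K"
          by blast
        have "norm (c m b - c n b) < e" if "m \<ge> N" "n \<ge> N" for m n
        proof -
          have eq: "(\<Sum>b\<in>B. scale (c m b - c n b) b) = v m - v n"
            unfolding c by (simp only: scale_left_diff_distrib sum_subtractf)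
          have "norm (c m b - c n b) \<le> M * norm (v m - v n)"
            using M[THEN spec, THEN bspec, OF b, of "\<lambda>b. c m b - c n b"] unfolding eq .
          also have "\<dots> \<le> K * norm (v m - v n)" by (rule mult_right_mono[OF K(2) norm_ge_zero])
          also have "\<dots> < e" using N[OF that] K(1) by (simp add: pos_less_divide_eq mult.commute)
          finally show ?thesis .
        qed
        then show "\<exists>N. \<forall>m\<ge>N. \<forall>n\<ge>N. norm (c m b - c n b) < e" by blast
      qed
      from complete[OF this] show ?thesis by (simp add: convergent_def)
    qed
    then obtain l where l: "\<And>b. b \<in> B \<Longrightarrow> (\<lambda>n. c n b) \<longlonglongrightarrow> l b" by metis
    have "v \<longlonglongrightarrow> (\<Sum>b\<in>B. scale (l b) b)"
      unfolding c[abs_def] by (intro tendsto_sum tendsto_scale l)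
    moreover have "(\<Sum>b\<in>B. scale (l b) b) \<in> span B"
      by (intro span_sum span_scale span_base)
    ultimately show ?thesis by blast
  qed

lemma closed_span_of_bounded_coordinates:
  assumes complete: "\<And>f::nat \<Rightarrow> 'k. Cauchy f \<Longrightarrow> convergent f"
    and B: "finite B"
    and M: "\<forall>c. \<forall>b\<in>B. norm (c b) \<le> M * norm (\<Sum>b\<in>B. scale (c b) b)"
  shows "closed (span B)"
  unfolding closed_sequential_limits
proof (intro allI impI, elim conjE)
  fix v l assume v: "\<forall>n. v n \<in> span B" and lim: "v \<longlonglongrightarrow> l"
  from v have "range v \<subseteq> span B" by auto
  from complete_span_of_bounded_coordinates[OF complete B M LIMSEQ_imp_Cauchy[OF lim] this]
  obtain w where w: "w \<in> span B" "v \<longlonglongrightarrow> w" ..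
  from w(1) show "l \<in> span B" unfolding LIMSEQ_unique[OF lim w(2)] .
qed

text \<open>
  Coordinates in a finite-dimensional space over a complete field are continuous. In the induction
  step the span of the old vectors is complete, hence closed, so the new vector has positive distance
  from it; this bounds the new coordinate, and then the others.
\<close>

lemma bounded_coordinates:
  assumes complete: "\<And>f::nat \<Rightarrow> 'k. Cauchy f \<Longrightarrow> convergent f"
    and "finite B" "independent B"
  shows "\<exists>M. \<forall>c. \<forall>b\<in>B. norm (c b) \<le> M * norm (\<Sum>b\<in>B. scale (c b) b)"
  using assms(2,3)
proof (induction B)
  case (insert y B)
  have B: "independent B" "y \<notin> span B"
    using insert.prems insert.hyps by (auto simp: independent_insert)
  from insert.IH[OF B(1)] obtain M
    where M: "\<forall>c. \<forall>b\<in>B. norm (c b) \<le> M * norm (\<Sum>b\<in>B. scale (c b) b)" ..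
  have "closed (span B)"
    by (rule closed_span_of_bounded_coordinates[OF complete insert.hyps(1) M])
  hence "open (- span B)" by (simp add: open_Compl)
  moreover have "y \<in> - span B" using B(2) by simp
  ultimately obtain d where d0: "0 < d" "\<forall>v. dist v y < d \<longrightarrow> v \<in> - span B"
    unfolding open_dist by blast
  have d: "0 < d" "\<And>v. v \<in> span B \<Longrightarrow> d \<le> dist y v"
  proof -
    fix v assume "v \<in> span B"
    hence "\<not> dist v y < d" using d0(2) by auto
    then show "d \<le> dist y v" by (simp add: dist_commute)
  qed (fact d0(1))
  have y: "norm (c y) \<le> (1 / d) * norm (\<Sum>b\<in>insert y B. scale (c b) b)" for c
  proof (cases "c y = 0")
    case False
    let ?v = "\<Sum>b\<in>B. scale (c b) b"
    have "scale (- inverse (c y)) ?v \<in> span B"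
      by (intro span_scale span_sum span_base)
    from d(2)[OF this] have "norm (c y) * d \<le> norm (c y) * norm (y + scale (inverse (c y)) ?v)"
      by (intro mult_left_mono) (simp_all add: dist_norm)
    also have "\<dots> = norm (scale (c y) (y + scale (inverse (c y)) ?v))"
      by (simp add: norm_scale)
    also have "scale (c y) (y + scale (inverse (c y)) ?v) = scale (c y) y + ?v"
      using False by (simp add: scale_right_distrib)
    finally show ?thesis using insert.hyps d(1) by (simp add: field_simps)
  qed (use d in simp)
  define M' where "M' = max (1 / d) (\<bar>M\<bar> * (1 + norm y / d))"
  have "norm (c b) \<le> M' * norm (\<Sum>b\<in>insert y B. scale (c b) b)" if "b \<in> insert y B" for c b
  proof (cases "b = y")
    case True
    have "norm (c b) \<le> (1 / d) * norm (\<Sum>b\<in>insert y B. scale (c b) b)" using y True by simp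
    also have "\<dots> \<le> M' * norm (\<Sum>b\<in>insert y B. scale (c b) b)"
      by (intro mult_right_mono) (simp_all add: M'_def)
    finally show ?thesis .
  next
    case False
    let ?s = "\<Sum>b\<in>insert y B. scale (c b) b"
    have "(\<Sum>b\<in>B. scale (c b) b) = ?s - scale (c y) y" using insert.hyps by simp
    hence "norm (\<Sum>b\<in>B. scale (c b) b) \<le> norm ?s + norm (c y) * norm y"
      using norm_triangle_ineq4[of ?s "scale (c y) y"] by (simp add: norm_scale)
    also have "\<dots> \<le> norm ?s + (1 / d) * norm ?s * norm y"
      by (intro add_left_mono mult_right_mono y) auto
    also have "\<dots> = (1 + norm y / d) * norm ?s" by (simp add: algebra_simps)
    finally have "\<bar>M\<bar> * norm (\<Sum>b\<in>B. scale (c b) b) \<le> \<bar>M\<bar> * ((1 + norm y / d) * norm ?s)"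
      by (intro mult_left_mono) auto
    moreover have "norm (c b) \<le> \<bar>M\<bar> * norm (\<Sum>b\<in>B. scale (c b) b)"
    proof -
      have "norm (c b) \<le> M * norm (\<Sum>b\<in>B. scale (c b) b)" using M that False by simp
      also have "\<dots> \<le> \<bar>M\<bar> * norm (\<Sum>b\<in>B. scale (c b) b)" by (intro mult_right_mono) auto
      finally show ?thesis .
    qed
    moreover have "\<bar>M\<bar> * ((1 + norm y / d) * norm ?s) \<le> M' * norm ?s"
      unfolding mult.assoc[symmetric] by (intro mult_right_mono) (simp_all add: M'_def)
    ultimately show ?thesis by linarith
  qed
  then show ?case by blast
qed simp

lemma complete_span:
  assumes complete: "\<And>f::nat \<Rightarrow> 'k. Cauchy f \<Longrightarrow> convergent f"
    and S: "finite S" and v: "Cauchy v" "\<And>n. \<exists>c. v n = (\<Sum>b\<in>S. scale (c b) b)"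
  shows "convergent v"
proof -
  obtain B where B: "B \<subseteq> S" "independent B" "S \<subseteq> span B"
    using maximal_independent_subset by blast
  have fin: "finite B" by (rule finite_subset[OF B(1) S])
  have sub: "span S \<subseteq> span B" by (rule span_minimal[OF B(3) subspace_span])
  obtain M where M: "\<forall>c. \<forall>b\<in>B. norm (c b) \<le> M * norm (\<Sum>b\<in>B. scale (c b) b)"
    using bounded_coordinates[OF complete fin B(2)] ..
  have "v n \<in> span S" for n
    using v(2)[of n] by (auto intro!: span_sum span_scale intro: span_base)
  hence "range v \<subseteq> span B" using sub by auto
  then obtain w where "v \<longlonglongrightarrow> w"
    using complete_span_of_bounded_coordinates[OF complete fin M v(1)] by blast
  then show ?thesis by (rule convergentI)
qed

end

text \<open>
  Completeness of the scalar field comes from Mazur's theorem: the field is a finite-dimensional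
  space over the reals.
\<close>

lemma real_normed_field_complete:
  fixes f :: "nat \<Rightarrow> 'k::real_normed_field"
  assumes "Cauchy f"
  shows "convergent f"
proof -
  obtain j :: 'k where j: "\<And>a. \<exists>s t. a = of_real s + of_real t * j"
    using real_normed_field_real_basis by blast
  interpret R: normed_space_over "scaleR :: real \<Rightarrow> 'k \<Rightarrow> 'k"
    by unfold_locales (auto simp: algebra_simps)
  have "\<exists>c. f n = (\<Sum>b\<in>{1, j}. c b *\<^sub>R b)" for n
  proof -
    obtain s t where st: "f n = s *\<^sub>R 1 + t *\<^sub>R j"
      using j[of "f n"] by (auto simp: scaleR_conv_of_real)
    show ?thesis
    proof (cases "j = 1")
      case True
      then show ?thesis using st by (intro exI[of _ "\<lambda>_. s + t"]) (simp add: scaleR_left_distrib)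
    next
      case False
      then show ?thesis using st by (intro exI[of _ "\<lambda>b. if b = 1 then s else t"]) simp
    qed
  qed
  then show ?thesis
    by (intro R.complete_span[OF _ _ assms, of "{1, j}"]) (auto intro: real_Cauchy_convergent)
qed

text \<open>coordinates\<close>

text \<open>
  The coordinates of \<open>T z\<close> with respect to a basis of the range are functionals of \<open>z\<close> that are linear
  over the scalar field. They are continuous because the scalar field is complete, so they tend to 0
  along a weakly null sequence.
\<close>

lemma finite_rank_weakly_null:
  fixes T :: "'x::banach \<Rightarrow>\<^sub>L 'y::banach" and sX :: "'k::real_normed_field \<Rightarrow> 'x \<Rightarrow> 'x"
  assumes "banach_space_over sX" "banach_space_over sY"
    and T: "T \<in> ops sX sY" "finite_rank sY T"
    and x: "\<And>f. f \<in> dual sX \<Longrightarrow> (\<lambda>n. blinfun_apply f (x n)) \<longlonglongrightarrow> 0"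
  shows "(\<lambda>n. blinfun_apply T (x n)) \<longlonglongrightarrow> 0"
proof -
  interpret X: banach_space_over sX by fact
  interpret Y: banach_space_over sY by fact
  interpret Y: normed_space_over sY by unfold_locales (rule Y.norm_scale)
  obtain S where S: "finite S" "range (blinfun_apply T) \<subseteq> Y.span S"
    using T(2) by (auto simp: finite_rank_def)
  obtain B where B: "B \<subseteq> S" "Y.independent B" "S \<subseteq> Y.span B"
    using Y.maximal_independent_subset by blast
  have fin: "finite B" by (rule finite_subset[OF B(1) S(1)])
  have "Y.span S \<subseteq> Y.span B" by (rule Y.span_minimal[OF B(3) Y.subspace_span])
  hence TB: "blinfun_apply T z \<in> Y.span B" for z using S(2) by blast
  obtain M where M: "\<forall>c. \<forall>b\<in>B. norm (c b) \<le> M * norm (\<Sum>b\<in>B. sY (c b) b)"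
    using Y.bounded_coordinates[OF real_normed_field_complete fin B(2)] ..
  define g where "g b z = Y.representation B (blinfun_apply T z) b" for b z
  have Tg: "blinfun_apply T z = (\<Sum>b\<in>B. sY (g b z) b)" for z
    unfolding g_def using Y.sum_representation_eq[OF B(2) TB fin] by simp
  have gX: "g b (sX a z) = a * g b z" for b a z
    using T(1) unfolding g_def by (simp add: ops_def Y.representation_scale[OF B(2) TB])
  have "(\<lambda>n. g b (x n)) \<longlonglongrightarrow> 0" if b: "b \<in> B" for b
  proof -
    have lin: "bounded_linear (g b)"
    proof (rule bounded_linear_intro[where K = "\<bar>M\<bar> * norm T"])
      show "g b (z + z') = g b z + g b z'" for z z'
        unfolding g_def by (simp add: blinfun.add_right Y.representation_add[OF B(2) TB TB])
      show "g b (r *\<^sub>R z) = r *\<^sub>R g b z" for r z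
        using gX[of b "of_real r" z] by (simp add: X.scale_of_real scaleR_conv_of_real)
      show "norm (g b z) \<le> norm z * (\<bar>M\<bar> * norm T)" for z
      proof -
        have "norm (g b z) \<le> M * norm (blinfun_apply T z)"
          using M[THEN spec, THEN bspec, OF b, of "\<lambda>b. g b z"] by (simp add: Tg)
        also have "\<dots> \<le> \<bar>M\<bar> * (norm T * norm z)"
          by (intro mult_mono norm_blinfun) auto
        finally show ?thesis by (simp add: mult_ac)
      qed
    qed
    have "Blinfun (g b) \<in> dual sX"
      by (simp add: dual_def ops_def bounded_linear_Blinfun_apply[OF lin] gX)
    from x[OF this] show ?thesis by (simp add: bounded_linear_Blinfun_apply[OF lin])
  qed
  hence "(\<lambda>n. \<Sum>b\<in>B. sY (g b (x n)) b) \<longlonglongrightarrow> (\<Sum>b\<in>B. sY 0 b)"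
    by (intro tendsto_sum Y.tendsto_scale)
  then show ?thesis by (simp add: Tg)
qed

section \<open>Schreier sequences and their norms\<close>

lemma schreier_seqs_iff:
  "\<alpha> \<in> schreier_seqs \<longleftrightarrow>
     finite {k. \<alpha> k \<noteq> 0} \<and> (\<forall>k. \<alpha> k \<noteq> 0 \<longrightarrow> card {k. \<alpha> k \<noteq> 0} \<le> Suc k)"
proof -
  define S where "S = {k. \<alpha> k \<noteq> 0}"
  have "Suc ` S \<in> schreier \<longleftrightarrow> (\<forall>k\<in>S. card S \<le> Suc k)" if "finite S"
  proof (cases "S = {}")
    case False
    have "card S \<le> Min (Suc ` S) \<longleftrightarrow> (\<forall>k\<in>S. card S \<le> Suc k)"
      using that False by (subst Min_ge_iff) auto
    then show ?thesis using that False by (auto simp: schreier_def card_image)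
  qed (simp add: schreier_def)
  then show ?thesis by (auto simp: schreier_seqs_def simp flip: S_def) (auto simp: S_def)
qed

lemma ereal_exponent_ge_1: "1 \<le> p \<Longrightarrow> p \<noteq> \<infinity> \<Longrightarrow> 1 \<le> real_of_ereal p"
  by (cases p) auto

lemma norm_le_lp_norm:
  assumes "1 \<le> p" "finite {k. \<alpha> k \<noteq> 0}"
  shows "norm (\<alpha> k) \<le> lp_norm p \<alpha>"
proof (cases "p = \<infinity>")
  case True
  have "range (\<lambda>k. norm (\<alpha> k)) \<subseteq> insert 0 ((\<lambda>k. norm (\<alpha> k)) ` {k. \<alpha> k \<noteq> 0})" by auto
  hence "bdd_above (range (\<lambda>k. norm (\<alpha> k)))"
    using assms(2) by (intro bdd_above_finite) (auto intro: finite_subset)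
  then show ?thesis using True by (auto simp: lp_norm_def intro: cSUP_upper)
next
  case False
  define r where "r = real_of_ereal p"
  have r: "1 \<le> r" unfolding r_def by (rule ereal_exponent_ge_1[OF assms(1) False])
  show ?thesis
  proof (cases "\<alpha> k = 0")
    case nz: False
    have "norm (\<alpha> k) = (norm (\<alpha> k) powr r) powr (1 / r)" using r by (simp add: powr_powr)
    also have "\<dots> \<le> (\<Sum>k | \<alpha> k \<noteq> 0. norm (\<alpha> k) powr r) powr (1 / r)"
      using assms(2) nz r by (intro powr_mono2 member_le_sum) auto
    finally show ?thesis using False by (simp add: lp_norm_def r_def)
  qed (use False in \<open>simp add: lp_norm_def\<close>)
qed

lemma lp_norm_nonneg:
  assumes "1 \<le> p" "finite {k. \<alpha> k \<noteq> 0}"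
  shows "0 \<le> lp_norm p \<alpha>"
  using norm_le_lp_norm[OF assms, of 0] norm_ge_zero order_trans by blast

lemma lp_norm_mono:
  assumes p: "1 \<le> p" and fin: "finite {k. \<alpha> k \<noteq> 0}"
    and le: "\<And>k. norm (\<beta> k) \<le> c * norm (\<alpha> k)" and c: "0 \<le> c"
  shows "lp_norm p \<beta> \<le> c * lp_norm p \<alpha>"
proof (cases "p = \<infinity>")
  case True
  have "norm (\<beta> k) \<le> c * lp_norm p \<alpha>" for k
    using le[of k] mult_left_mono[OF norm_le_lp_norm[OF p fin, of k] c] by linarith
  then show ?thesis using True by (auto simp: lp_norm_def[of _ \<beta>] intro!: cSUP_least)
next
  case False
  define r where "r = real_of_ereal p"
  have r: "1 \<le> r" unfolding r_def by (rule ereal_exponent_ge_1[OF p False])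
  have "{k. \<beta> k \<noteq> 0} \<subseteq> {k. \<alpha> k \<noteq> 0}"
    using le by (metis (mono_tags, lifting) Collect_mono mult_zero_right norm_le_zero_iff norm_zero)
  hence "(\<Sum>k | \<beta> k \<noteq> 0. norm (\<beta> k) powr r) \<le> (\<Sum>k | \<alpha> k \<noteq> 0. norm (\<beta> k) powr r)"
    using fin by (intro sum_mono2) auto
  also have "\<dots> \<le> (\<Sum>k | \<alpha> k \<noteq> 0. (c * norm (\<alpha> k)) powr r)"
    using r le by (intro sum_mono powr_mono2) auto
  also have "\<dots> = c powr r * (\<Sum>k | \<alpha> k \<noteq> 0. norm (\<alpha> k) powr r)"
    using c by (simp add: powr_mult sum_distrib_left)
  finally have "(\<Sum>k | \<beta> k \<noteq> 0. norm (\<beta> k) powr r) powr (1 / r)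
      \<le> (c powr r * (\<Sum>k | \<alpha> k \<noteq> 0. norm (\<alpha> k) powr r)) powr (1 / r)"
    using r by (intro powr_mono2) (auto intro: sum_nonneg)
  also have "\<dots> = c * (\<Sum>k | \<alpha> k \<noteq> 0. norm (\<alpha> k) powr r) powr (1 / r)"
    using r c by (simp add: powr_mult powr_powr sum_nonneg)
  finally show ?thesis using False by (simp add: lp_norm_def r_def)
qed

text \<open>
  The sequence \<open>\<beta>\<close> carries the entries of \<open>\<alpha>\<close> to the positions \<open>t k\<close> and vanishes elsewhere.
\<close>

lemma lp_norm_reindex_le:
  assumes p: "1 \<le> p" and fin: "finite {k. \<alpha> k \<noteq> 0}" and inj: "inj_on t {k. \<alpha> k \<noteq> 0}"
    and eq: "\<And>k. \<alpha> k \<noteq> 0 \<Longrightarrow> \<beta> (t k) = \<alpha> k" and supp: "{k. \<beta> k \<noteq> 0} = t ` {k. \<alpha> k \<noteq> 0}"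
  shows "lp_norm p \<beta> \<le> lp_norm p \<alpha>"
proof (cases "p = \<infinity>")
  case True
  have "norm (\<beta> k) \<le> lp_norm p \<alpha>" for k
  proof (cases "\<beta> k = 0")
    case False
    then obtain i where "\<alpha> i \<noteq> 0" "k = t i" using supp by blast
    then show ?thesis using norm_le_lp_norm[OF p fin, of i] eq by simp
  qed (use lp_norm_nonneg[OF p fin] in simp)
  then show ?thesis using True by (auto simp: lp_norm_def[of _ \<beta>] intro!: cSUP_least)
next
  case False
  then show ?thesis
    by (simp add: lp_norm_def supp sum.reindex[OF inj] eq)
qed

section \<open>Estimates over Schreier sets\<close>

definition schreier_dominated ::
  "('k::real_normed_field \<Rightarrow> 'y::real_normed_vector \<Rightarrow> 'y) \<Rightarrow> ereal \<Rightarrow> real \<Rightarrow> (nat \<Rightarrow> 'y) \<Rightarrow> bool" where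
  "schreier_dominated sY p C y \<longleftrightarrow>
     (\<forall>\<alpha>\<in>schreier_seqs. norm (\<Sum>k | \<alpha> k \<noteq> 0. sY (\<alpha> k) (y k)) \<le> C * lp_norm p \<alpha>)"

definition weakly_null ::
  "('k::real_normed_field \<Rightarrow> 'x::real_normed_vector \<Rightarrow> 'x) \<Rightarrow> (nat \<Rightarrow> 'x) \<Rightarrow> bool" where
  "weakly_null sX x \<longleftrightarrow> (\<forall>f\<in>dual sX. (\<lambda>n. blinfun_apply f (x n)) \<longlonglongrightarrow> 0)"

lemma normalized_weakly_null_iff:
  "normalized_weakly_null sX x \<longleftrightarrow> (\<forall>n. norm (x n) = 1) \<and> weakly_null sX x"
  by (simp add: normalized_weakly_null_def weakly_null_def)

lemma weakly_null_subseq: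
  "weakly_null sX x \<Longrightarrow> strict_mono n \<Longrightarrow> weakly_null sX (\<lambda>k. x (n k))"
  unfolding weakly_null_def
  by (auto dest!: bspec intro: LIMSEQ_subseq_LIMSEQ[unfolded comp_def])

lemma normalized_weakly_null_subseq:
  "normalized_weakly_null sX x \<Longrightarrow> strict_mono n \<Longrightarrow> normalized_weakly_null sX (\<lambda>k. x (n k))"
  by (simp add: normalized_weakly_null_iff weakly_null_subseq)

lemma WD_iff:
  "T \<in> WD p C sX sY \<longleftrightarrow> T \<in> ops sX sY \<and>
     (\<forall>\<epsilon>>0. \<forall>x. normalized_weakly_null sX x \<longrightarrow>
        (\<exists>n. strict_mono n \<and> schreier_dominated sY p (C + \<epsilon>) (\<lambda>k. blinfun_apply T (x (n k)))))"
  by (simp add: WD_def schreier_dominated_def)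

lemma schreier_dominated_mono:
  assumes "1 \<le> p" "schreier_dominated sY p C y" "C \<le> D"
  shows "schreier_dominated sY p D y"
  unfolding schreier_dominated_def
proof
  fix \<alpha> :: "nat \<Rightarrow> 'a" assume \<alpha>: "\<alpha> \<in> schreier_seqs"
  hence "norm (\<Sum>k | \<alpha> k \<noteq> 0. sY (\<alpha> k) (y k)) \<le> C * lp_norm p \<alpha>"
    using assms(2) by (simp add: schreier_dominated_def)
  also have "\<dots> \<le> D * lp_norm p \<alpha>"
    using assms(1,3) \<alpha> by (intro mult_right_mono lp_norm_nonneg) (auto simp: schreier_seqs_iff)
  finally show "norm (\<Sum>k | \<alpha> k \<noteq> 0. sY (\<alpha> k) (y k)) \<le> D * lp_norm p \<alpha>" .
qed

text \<open>
  The Schreier family is spreading: moving the elements of a Schreier set to the right raises the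
  minimum and keeps the number of elements. Hence estimates over Schreier sets pass to subsequences.
  The index map is only constrained on the support, which allows it to depend on the coefficients.
\<close>

lemma schreier_dominated_reindex:
  assumes p: "1 \<le> p" and dom: "schreier_dominated sY p C y" and C: "0 \<le> C"
    and \<alpha>: "\<alpha> \<in> schreier_seqs" and inj: "inj_on t {k. \<alpha> k \<noteq> 0}"
    and t: "\<And>k. \<alpha> k \<noteq> 0 \<Longrightarrow> k \<le> t k"
  shows "norm (\<Sum>k | \<alpha> k \<noteq> 0. sY (\<alpha> k) (y (t k))) \<le> C * lp_norm p \<alpha>"
proof -
  let ?S = "{k. \<alpha> k \<noteq> 0}"
  define \<beta> where "\<beta> i = (if i \<in> t ` ?S then \<alpha> (inv_into ?S t i) else 0)" for i
  have eq: "\<beta> (t k) = \<alpha> k" if "\<alpha> k \<noteq> 0" for k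
    using that inj by (simp add: \<beta>_def)
  have supp: "{k. \<beta> k \<noteq> 0} = t ` ?S"
  proof (intro set_eqI iffI)
    fix i assume "i \<in> t ` ?S"
    then show "i \<in> {k. \<beta> k \<noteq> 0}" using eq by auto
  qed (auto simp: \<beta>_def split: if_splits)
  have fin: "finite ?S" using \<alpha> by (simp add: schreier_seqs_iff)
  have "\<beta> \<in> schreier_seqs"
    unfolding schreier_seqs_iff supp card_image[OF inj]
  proof (intro conjI allI impI)
    show "finite (t ` ?S)" using fin by simp
    fix i assume "\<beta> i \<noteq> 0"
    then obtain k where "\<alpha> k \<noteq> 0" "i = t k" using supp by blast
    with \<alpha> have "card ?S \<le> Suc k" by (simp add: schreier_seqs_iff)
    also have "\<dots> \<le> Suc i" using t[of k] \<open>\<alpha> k \<noteq> 0\<close> \<open>i = t k\<close> by simp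
    finally show "card ?S \<le> Suc i" .
  qed
  have "(\<Sum>k | \<alpha> k \<noteq> 0. sY (\<alpha> k) (y (t k))) = (\<Sum>k | \<beta> k \<noteq> 0. sY (\<beta> k) (y k))"
    unfolding supp by (simp add: sum.reindex[OF inj] eq)
  also have "norm \<dots> \<le> C * lp_norm p \<beta>"
    using dom \<open>\<beta> \<in> schreier_seqs\<close> by (simp add: schreier_dominated_def)
  also have "\<dots> \<le> C * lp_norm p \<alpha>"
    by (intro mult_left_mono C lp_norm_reindex_le[OF p fin inj eq supp])
  finally show ?thesis .
qed

lemma schreier_dominated_subseq:
  assumes "1 \<le> p" "schreier_dominated sY p C y" "0 \<le> C" "strict_mono n"
  shows "schreier_dominated sY p C (\<lambda>k. y (n k))"
  unfolding schreier_dominated_def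
proof
  fix \<alpha> :: "nat \<Rightarrow> 'a" assume \<alpha>: "\<alpha> \<in> schreier_seqs"
  show "norm (\<Sum>k | \<alpha> k \<noteq> 0. sY (\<alpha> k) (y (n k))) \<le> C * lp_norm p \<alpha>"
  proof (rule schreier_dominated_reindex[OF assms(1-3) \<alpha>])
    show "inj_on n {k. \<alpha> k \<noteq> 0}"
      by (rule strict_mono_imp_inj_on[OF assms(4)])
  qed (rule strict_mono_imp_increasing[OF assms(4)])
qed

context banach_space_over
begin

lemma schreier_dominated_add:
  assumes "schreier_dominated scale p C y" "schreier_dominated scale p D z"
  shows "schreier_dominated scale p (C + D) (\<lambda>k. y k + z k)"
  unfolding schreier_dominated_def
proof
  fix \<alpha> :: "nat \<Rightarrow> 'k" assume \<alpha>: "\<alpha> \<in> schreier_seqs"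
  have "norm (\<Sum>k | \<alpha> k \<noteq> 0. scale (\<alpha> k) (y k + z k))
      \<le> norm (\<Sum>k | \<alpha> k \<noteq> 0. scale (\<alpha> k) (y k)) + norm (\<Sum>k | \<alpha> k \<noteq> 0. scale (\<alpha> k) (z k))"
    by (simp add: scale_right_distrib sum.distrib norm_triangle_ineq)
  also have "\<dots> \<le> C * lp_norm p \<alpha> + D * lp_norm p \<alpha>"
    using assms \<alpha> by (intro add_mono) (auto simp: schreier_dominated_def)
  finally show "norm (\<Sum>k | \<alpha> k \<noteq> 0. scale (\<alpha> k) (y k + z k)) \<le> (C + D) * lp_norm p \<alpha>"
    by (simp add: distrib_right)
qed

text \<open>
  The factors are moved from the vectors into the coefficients. Being positive, they leave the support
  unchanged, so that the new coefficients form a Schreier sequence again.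
\<close>

lemma schreier_dominated_scaleR:
  assumes p: "1 \<le> p" and dom: "schreier_dominated scale p C y" and C: "0 \<le> C"
    and r: "\<And>k. 0 < r k \<and> r k \<le> K"
  shows "schreier_dominated scale p (K * C) (\<lambda>k. r k *\<^sub>R y k)"
  unfolding schreier_dominated_def
proof
  fix \<alpha> :: "nat \<Rightarrow> 'k" assume \<alpha>: "\<alpha> \<in> schreier_seqs"
  define \<beta> where "\<beta> k = of_real (r k) * \<alpha> k" for k
  have supp: "\<beta> k \<noteq> 0 \<longleftrightarrow> \<alpha> k \<noteq> 0" for k using r[of k] by (simp add: \<beta>_def)
  have "(\<Sum>k | \<alpha> k \<noteq> 0. scale (\<alpha> k) (r k *\<^sub>R y k)) = (\<Sum>k | \<beta> k \<noteq> 0. scale (\<beta> k) (y k))"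
    unfolding supp by (simp add: \<beta>_def mult.commute flip: scale_of_real)
  also have "norm \<dots> \<le> C * lp_norm p \<beta>"
  proof -
    have "\<beta> \<in> schreier_seqs" using \<alpha> by (simp add: schreier_seqs_iff supp)
    then show ?thesis using dom by (simp add: schreier_dominated_def)
  qed
  also have "\<dots> \<le> C * (K * lp_norm p \<alpha>)"
  proof (intro mult_left_mono lp_norm_mono p C)
    show "finite {k. \<alpha> k \<noteq> 0}" using \<alpha> by (simp add: schreier_seqs_iff)
    show "norm (\<beta> k) \<le> K * norm (\<alpha> k)" for k
      using r[of k] by (simp add: \<beta>_def norm_mult mult_right_mono)
    show "0 \<le> K" using r[of 0] by simp
  qed
  finally show "norm (\<Sum>k | \<alpha> k \<noteq> 0. scale (\<alpha> k) (r k *\<^sub>R y k)) \<le> K * C * lp_norm p \<alpha>"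
    by (simp add: mult_ac)
qed

text \<open>
  A Schreier set containing \<open>l\<close> has at most \<open>Suc l\<close> elements, and coefficients are bounded by the
  \<open>\<ell>\<^sub>p\<close> norm, so vectors of norm \<open>\<eta> / Suc l\<close> contribute at most \<open>\<eta>\<close> times that norm in total.
\<close>

lemma norm_schreier_sum_le:
  assumes p: "1 \<le> p" and \<alpha>: "\<alpha> \<in> schreier_seqs" and l: "\<alpha> l \<noteq> 0" and \<eta>: "0 \<le> \<eta>"
    and y: "\<And>k. \<alpha> k \<noteq> 0 \<Longrightarrow> norm (y k) \<le> \<eta> / Suc l"
  shows "norm (\<Sum>k | \<alpha> k \<noteq> 0. scale (\<alpha> k) (y k)) \<le> \<eta> * lp_norm p \<alpha>"
proof -
  have fin: "finite {k. \<alpha> k \<noteq> 0}" and card: "card {k. \<alpha> k \<noteq> 0} \<le> Suc l"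
    using \<alpha> l by (auto simp: schreier_seqs_iff)
  have lp: "0 \<le> lp_norm p \<alpha>" by (rule lp_norm_nonneg[OF p fin])
  have "norm (\<Sum>k | \<alpha> k \<noteq> 0. scale (\<alpha> k) (y k)) \<le> (\<Sum>k | \<alpha> k \<noteq> 0. lp_norm p \<alpha> * (\<eta> / Suc l))"
  proof (intro order_trans[OF norm_sum] sum_mono)
    fix k assume "k \<in> {k. \<alpha> k \<noteq> 0}"
    then show "norm (scale (\<alpha> k) (y k)) \<le> lp_norm p \<alpha> * (\<eta> / Suc l)"
      unfolding norm_scale using lp by (intro mult_mono norm_le_lp_norm[OF p fin] y) auto
  qed
  also have "\<dots> = real (card {k. \<alpha> k \<noteq> 0}) * (lp_norm p \<alpha> * (\<eta> / Suc l))" by simp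
  also have "\<dots> \<le> real (Suc l) * (lp_norm p \<alpha> * (\<eta> / Suc l))"
    using card \<eta> lp by (intro mult_right_mono) auto
  also have "\<dots> = \<eta> * lp_norm p \<alpha>" by simp
  finally show ?thesis .
qed

lemma schreier_dominated_null:
  assumes "1 \<le> p" "0 \<le> \<eta>" and y: "\<And>k. norm (y k) \<le> \<eta> / Suc k"
  shows "schreier_dominated scale p \<eta> y"
  unfolding schreier_dominated_def
proof
  fix \<alpha> :: "nat \<Rightarrow> 'k" assume \<alpha>: "\<alpha> \<in> schreier_seqs"
  hence fin: "finite {k. \<alpha> k \<noteq> 0}" by (simp add: schreier_seqs_iff)
  show "norm (\<Sum>k | \<alpha> k \<noteq> 0. scale (\<alpha> k) (y k)) \<le> \<eta> * lp_norm p \<alpha>"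
  proof (cases "{k. \<alpha> k \<noteq> 0} = {}")
    case True
    have "0 \<le> \<eta> * lp_norm p \<alpha>"
      by (rule mult_nonneg_nonneg[OF assms(2) lp_norm_nonneg[OF assms(1) fin]])
    then show ?thesis unfolding True by simp
  next
    case False
    define l where "l = Min {k. \<alpha> k \<noteq> 0}"
    have l: "\<alpha> l \<noteq> 0" using Min_in[OF fin False] by (simp add: l_def)
    have le: "norm (y k) \<le> \<eta> / Suc l" if "\<alpha> k \<noteq> 0" for k
    proof -
      have "l \<le> k" using Min_le[OF fin] that by (simp add: l_def)
      then have "\<eta> / Suc k \<le> \<eta> / Suc l" using assms(2) by (intro divide_left_mono) auto
      with y[of k] show ?thesis by linarith
    qed
    show ?thesis by (rule norm_schreier_sum_le[OF assms(1) \<alpha> l assms(2) le])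
  qed
qed

end

lemma strict_mono_small_subseq:
  fixes y :: "nat \<Rightarrow> 'y::real_normed_vector"
  assumes small: "\<And>\<delta> N. 0 < \<delta> \<Longrightarrow> \<exists>n\<ge>N. norm (y n) < \<delta>" and "0 < \<eta>"
  obtains r where "strict_mono r" "\<And>k. norm (y (r k)) \<le> \<eta> / Suc k"
proof -
  have ex: "\<exists>n>N. norm (y n) \<le> \<eta> / Suc k" for N k
    using small[of "\<eta> / Suc k" "Suc N"] \<open>0 < \<eta>\<close> by (auto simp: Suc_le_eq intro: less_imp_le)
  have "\<exists>r. \<forall>k. norm (y (r k)) \<le> \<eta> / Suc k \<and> r k < r (Suc k)"
  proof (rule dependent_nat_choice)
    show "\<exists>n. norm (y n) \<le> \<eta> / Suc 0" using ex by blast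
    show "\<exists>m. norm (y m) \<le> \<eta> / Suc (Suc k) \<and> n < m" for n k using ex by blast
  qed
  then show thesis using that by (auto simp: strict_mono_Suc_iff)
qed

text \<open>
  The defining estimate extends from normalized to bounded weakly null sequences. If the norms of the
  terms come arbitrarily close to 0, a subsequence tends to 0 fast enough for the estimate to hold with
  constant \<open>\<epsilon>\<close>. Otherwise they are eventually bounded below, \<open>x\<close> can be normalized, and the norms are
  moved into the coefficients, which multiplies the \<open>\<ell>\<^sub>p\<close> norm by at most \<open>K\<close>.
\<close>

lemma WD_bounded_weakly_null:
  assumes p: "1 \<le> p" and X: "banach_space_over sX" and Y: "banach_space_over sY"
    and T: "T \<in> WD p C sX sY" and C: "0 \<le> C"
    and x: "weakly_null sX x" and K: "\<And>n. norm (x n) \<le> K" and \<epsilon>: "0 < \<epsilon>"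
  obtains n where "strict_mono n" "schreier_dominated sY p (K * C + \<epsilon>) (\<lambda>k. blinfun_apply T (x (n k)))"
proof (cases "\<forall>\<delta>>0. \<forall>N. \<exists>n\<ge>N. norm (x n) < \<delta>")
  case True
  interpret Y: banach_space_over sY by fact
  define \<eta> where "\<eta> = \<epsilon> / (norm T + 1)"
  have den: "0 < norm T + 1" using norm_ge_zero[of T] by linarith
  hence \<eta>: "0 < \<eta>" using \<epsilon> by (simp add: \<eta>_def)
  obtain n where n: "strict_mono n" "\<And>k. norm (x (n k)) \<le> \<eta> / Suc k"
    by (rule strict_mono_small_subseq[of x \<eta>]) (use True \<eta> in auto)
  have "schreier_dominated sY p \<epsilon> (\<lambda>k. blinfun_apply T (x (n k)))"
  proof (rule Y.schreier_dominated_null[OF p])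
    fix k
    have "norm (blinfun_apply T (x (n k))) \<le> (norm T + 1) * norm (x (n k))"
      by (rule order_trans[OF norm_blinfun]) (simp add: mult_right_mono)
    also have "\<dots> \<le> (norm T + 1) * (\<eta> / Suc k)" using den n(2) by (intro mult_left_mono) auto
    also have "\<dots> = \<epsilon> / Suc k" using den by (simp add: \<eta>_def)
    finally show "norm (blinfun_apply T (x (n k))) \<le> \<epsilon> / Suc k" .
  qed (use \<epsilon> in simp)
  moreover have "0 \<le> K" using K norm_ge_zero order_trans by blast
  ultimately have "schreier_dominated sY p (K * C + \<epsilon>) (\<lambda>k. blinfun_apply T (x (n k)))"
    using C by (elim schreier_dominated_mono[OF p]) simp
  with n(1) show ?thesis by (rule that)
next
  case False
  interpret X: banach_space_over sX by fact
  interpret Y: banach_space_over sY by fact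
  from False obtain \<delta> N where \<delta>: "0 < \<delta>" "\<And>n. N \<le> n \<Longrightarrow> \<delta> \<le> norm (x n)"
    by (force simp: not_less)
  define z where "z n = inverse (norm (x (n + N))) *\<^sub>R x (n + N)" for n
  have pos: "0 < norm (x (n + N))" for n using \<delta>(1) \<delta>(2)[of "n + N"] by linarith
  have "normalized_weakly_null sX z"
    unfolding normalized_weakly_null_iff weakly_null_def
  proof (intro conjI allI ballI)
    show "norm (z n) = 1" for n
    proof -
      have "norm (x (n + N)) \<noteq> 0" using pos[of n] by linarith
      then show ?thesis by (simp add: z_def)
    qed
    fix f assume f: "f \<in> dual sX"
    hence "(\<lambda>n. blinfun_apply f (x (n + N))) \<longlonglongrightarrow> 0"
      using x by (intro LIMSEQ_ignore_initial_segment) (simp add: weakly_null_def)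
    hence lim: "(\<lambda>n. inverse \<delta> * norm (blinfun_apply f (x (n + N)))) \<longlonglongrightarrow> inverse \<delta> * 0"
      by (intro tendsto_mult tendsto_const tendsto_norm_zero)
    have bd: "norm (blinfun_apply f (z n)) \<le> inverse \<delta> * norm (blinfun_apply f (x (n + N)))" for n
      using \<delta> pos[of n] by (auto simp: z_def blinfun.scaleR_right intro!: mult_right_mono le_imp_inverse_le)
    show "(\<lambda>n. blinfun_apply f (z n)) \<longlonglongrightarrow> 0"
      by (rule tendsto_0_le[OF lim[unfolded mult_zero_right], of _ 1]) (use bd \<delta>(1) in \<open>simp add: abs_mult\<close>)
  qed
  define \<epsilon>' where "\<epsilon>' = \<epsilon> / (K + 1)"
  have K0: "0 \<le> K" using K norm_ge_zero order_trans by blast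
  hence "0 < \<epsilon>'" using \<epsilon> by (simp add: \<epsilon>'_def)
  with T \<open>normalized_weakly_null sX z\<close> obtain n where n: "strict_mono n"
    "schreier_dominated sY p (C + \<epsilon>') (\<lambda>k. blinfun_apply T (z (n k)))"
    unfolding WD_iff by blast
  have "schreier_dominated sY p (K * (C + \<epsilon>')) (\<lambda>k. norm (x (n k + N)) *\<^sub>R blinfun_apply T (z (n k)))"
    by (rule Y.schreier_dominated_scaleR[OF p n(2)]) (use C \<open>0 < \<epsilon>'\<close> pos K in auto)
  also have "(\<lambda>k. norm (x (n k + N)) *\<^sub>R blinfun_apply T (z (n k))) = (\<lambda>k. blinfun_apply T (x (n k + N)))"
    using pos by (auto simp: z_def blinfun.scaleR_right)
  finally have "schreier_dominated sY p (K * C + \<epsilon>) (\<lambda>k. blinfun_apply T (x (n k + N)))"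
    by (rule schreier_dominated_mono[OF p]) (use K0 \<epsilon> in \<open>simp add: \<epsilon>'_def field_simps\<close>)
  moreover have "strict_mono (\<lambda>k. n k + N)" using n(1) by (simp add: strict_mono_def)
  ultimately show ?thesis using that[of "\<lambda>k. n k + N"] by blast
qed

lemma weakly_null_image:
  assumes x: "weakly_null sW x" and A: "A \<in> ops sW sX"
  shows "weakly_null sX (\<lambda>n. blinfun_apply A (x n))"
  unfolding weakly_null_def
proof
  fix f assume f: "f \<in> dual sX"
  hence "f o\<^sub>L A \<in> dual sW" using A by (simp add: dual_def ops_def)
  then show "(\<lambda>n. blinfun_apply f (blinfun_apply A (x n))) \<longlonglongrightarrow> 0"
    using x by (force simp: weakly_null_def)
qed

lemma schreier_dominated_image:
  fixes sY :: "'k::real_normed_field \<Rightarrow> 'y::real_normed_vector \<Rightarrow> 'y"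
    and sZ :: "'k \<Rightarrow> 'z::real_normed_vector \<Rightarrow> 'z"
  assumes p: "1 \<le> p" and B: "B \<in> ops sY sZ" and dom: "schreier_dominated sY p C y"
  shows "schreier_dominated sZ p (norm B * C) (\<lambda>k. blinfun_apply B (y k))"
  unfolding schreier_dominated_def
proof
  fix \<alpha> :: "nat \<Rightarrow> 'k" assume \<alpha>: "\<alpha> \<in> schreier_seqs"
  have "(\<Sum>k | \<alpha> k \<noteq> 0. sZ (\<alpha> k) (blinfun_apply B (y k)))
      = blinfun_apply B (\<Sum>k | \<alpha> k \<noteq> 0. sY (\<alpha> k) (y k))"
    using B by (simp add: ops_def blinfun.sum_right)
  also have "norm \<dots> \<le> norm B * norm (\<Sum>k | \<alpha> k \<noteq> 0. sY (\<alpha> k) (y k))" by (rule norm_blinfun)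
  also have "\<dots> \<le> norm B * (C * lp_norm p \<alpha>)"
    using dom \<alpha> by (intro mult_left_mono) (auto simp: schreier_dominated_def)
  finally show "norm (\<Sum>k | \<alpha> k \<noteq> 0. sZ (\<alpha> k) (blinfun_apply B (y k))) \<le> norm B * C * lp_norm p \<alpha>"
    by (simp add: mult_ac)
qed

text \<open>
  An operator maps weakly null sequences to weakly null sequences but does not keep them normalized,
  whence the use of the estimate for bounded sequences.
\<close>

lemma WD_compose:
  assumes p: "1 \<le> p" and X: "banach_space_over sX" and Y: "banach_space_over sY"
    and T: "T \<in> WD p C sX sY" and C: "0 \<le> C" and A: "A \<in> ops sW sX" and B: "B \<in> ops sY sZ"
  shows "B o\<^sub>L T o\<^sub>L A \<in> WD p (norm B * C * norm A) sW sZ"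
  unfolding WD_iff
proof (intro conjI allI impI)
  show "B o\<^sub>L T o\<^sub>L A \<in> ops sW sZ" using T A B by (simp add: WD_iff ops_def)
  fix \<epsilon> :: real and x assume \<epsilon>: "0 < \<epsilon>" and x: "normalized_weakly_null sW x"
  have den: "0 < norm B + 1" using norm_ge_zero[of B] by linarith
  obtain n where n: "strict_mono n"
    "schreier_dominated sY p (norm A * C + \<epsilon> / (norm B + 1)) (\<lambda>k. blinfun_apply T (blinfun_apply A (x (n k))))"
  proof (rule WD_bounded_weakly_null[OF p X Y T C, of "\<lambda>k. blinfun_apply A (x k)"])
    show "weakly_null sX (\<lambda>k. blinfun_apply A (x k))"
      using x A weakly_null_image by (auto simp: normalized_weakly_null_iff)
    show "norm (blinfun_apply A (x k)) \<le> norm A" for k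
      using norm_blinfun[of A "x k"] x by (simp add: normalized_weakly_null_iff)
    show "0 < \<epsilon> / (norm B + 1)" using \<epsilon> den by simp
  qed
  have "schreier_dominated sZ p (norm B * C * norm A + \<epsilon>) (\<lambda>k. blinfun_apply (B o\<^sub>L T o\<^sub>L A) (x (n k)))"
    using schreier_dominated_image[OF p B n(2)]
    unfolding blinfun_apply_blinfun_compose
  proof (rule schreier_dominated_mono[OF p])
    have "norm B * (\<epsilon> / (norm B + 1)) \<le> \<epsilon>" using \<epsilon> den by (simp add: field_simps)
    then show "norm B * (norm A * C + \<epsilon> / (norm B + 1)) \<le> norm B * C * norm A + \<epsilon>"
      by (simp add: algebra_simps)
  qed
  with n(1) show "\<exists>n. strict_mono n \<and>
    schreier_dominated sZ p (norm B * C * norm A + \<epsilon>) (\<lambda>k. blinfun_apply (B o\<^sub>L T o\<^sub>L A) (x (n k)))"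
    by blast
qed

section \<open>Sums, finite-rank operators and limits\<close>

lemma ops_iff: "T \<in> ops sX sY \<longleftrightarrow> (\<forall>a x. blinfun_apply T (sX a x) = sY a (blinfun_apply T x))"
  by (simp add: ops_def)

lemma WD_mono:
  assumes p: "1 \<le> p" and T: "T \<in> WD p C sX sY" and CD: "C \<le> D"
  shows "T \<in> WD p D sX sY"
  unfolding WD_iff
proof (intro conjI allI impI)
  show "T \<in> ops sX sY" using T by (simp add: WD_iff)
  fix \<epsilon> :: real and x assume "0 < \<epsilon>" "normalized_weakly_null sX x"
  then obtain n where n: "strict_mono n"
    "schreier_dominated sY p (C + \<epsilon>) (\<lambda>k. blinfun_apply T (x (n k)))"
    using T unfolding WD_iff by blast
  from n(2) have "schreier_dominated sY p (D + \<epsilon>) (\<lambda>k. blinfun_apply T (x (n k)))"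
    by (rule schreier_dominated_mono[OF p]) (use CD in simp)
  with n(1) show "\<exists>n. strict_mono n \<and> schreier_dominated sY p (D + \<epsilon>) (\<lambda>k. blinfun_apply T (x (n k)))"
    by blast
qed

lemma WD_add:
  assumes p: "1 \<le> p" and Y: "banach_space_over sY"
    and S: "S \<in> WD p C sX sY" and T: "T \<in> WD p D sX sY" and C: "0 \<le> C"
  shows "S + T \<in> WD p (C + D) sX sY"
  unfolding WD_iff
proof (intro conjI allI impI)
  interpret Y: banach_space_over sY by fact
  show "S + T \<in> ops sX sY"
    using S T by (simp add: WD_iff ops_iff blinfun.add_left Y.scale_right_distrib)
  fix \<epsilon> :: real and x assume \<epsilon>: "0 < \<epsilon>" and x: "normalized_weakly_null sX x"
  have \<epsilon>2: "0 < \<epsilon> / 2" using \<epsilon> by simp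
  obtain m where m: "strict_mono m"
    "schreier_dominated sY p (C + \<epsilon> / 2) (\<lambda>k. blinfun_apply S (x (m k)))"
    using S x \<epsilon>2 unfolding WD_iff by blast
  obtain n where n: "strict_mono n"
    "schreier_dominated sY p (D + \<epsilon> / 2) (\<lambda>k. blinfun_apply T (x (m (n k))))"
    using T normalized_weakly_null_subseq[OF x m(1)] \<epsilon>2 unfolding WD_iff by blast
  have "schreier_dominated sY p (C + \<epsilon> / 2) (\<lambda>k. blinfun_apply S (x (m (n k))))"
    using schreier_dominated_subseq[OF p m(2) _ n(1)] C \<epsilon> by simp
  from Y.schreier_dominated_add[OF this n(2)]
  have "schreier_dominated sY p (C + D + \<epsilon>) (\<lambda>k. blinfun_apply (S + T) (x (m (n k))))"
    by (simp add: blinfun.add_left algebra_simps)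
  moreover have "strict_mono (\<lambda>k. m (n k))" using m(1) n(1) by (simp add: strict_mono_def)
  ultimately show "\<exists>n. strict_mono n \<and>
      schreier_dominated sY p (C + D + \<epsilon>) (\<lambda>k. blinfun_apply (S + T) (x (n k)))"
    by (intro exI[of _ "\<lambda>k. m (n k)"]) blast
qed

lemma finite_rank_WD:
  assumes p: "1 \<le> p" and X: "banach_space_over sX" and Y: "banach_space_over sY"
    and T: "T \<in> ops sX sY" "finite_rank sY T"
  shows "T \<in> WD p 0 sX sY"
  unfolding WD_iff
proof (intro conjI allI impI T(1))
  interpret Y: banach_space_over sY by fact
  fix \<epsilon> :: real and x assume \<epsilon>: "0 < \<epsilon>" and x: "normalized_weakly_null sX x"
  have lim: "(\<lambda>n. blinfun_apply T (x n)) \<longlonglongrightarrow> 0"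
    by (rule finite_rank_weakly_null[OF X Y T]) (use x in \<open>simp add: normalized_weakly_null_def\<close>)
  obtain n where n: "strict_mono n" "\<And>k. norm (blinfun_apply T (x (n k))) \<le> \<epsilon> / Suc k"
  proof (rule strict_mono_small_subseq[OF _ \<epsilon>, of "\<lambda>n. blinfun_apply T (x n)"])
    fix \<delta> :: real and N :: nat assume "0 < \<delta>"
    then obtain M where "\<And>n. n \<ge> M \<Longrightarrow> norm (blinfun_apply T (x n)) < \<delta>"
      using LIMSEQ_D[OF lim] by force
    then show "\<exists>n\<ge>N. norm (blinfun_apply T (x n)) < \<delta>"
      by (intro exI[of _ "max M N"]) simp
  qed (rule that)
  have "schreier_dominated sY p (0 + \<epsilon>) (\<lambda>k. blinfun_apply T (x (n k)))"
    unfolding add_0 by (rule Y.schreier_dominated_null[OF p less_imp_le[OF \<epsilon>] n(2)])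
  with n(1) show "\<exists>n. strict_mono n \<and> schreier_dominated sY p (0 + \<epsilon>) (\<lambda>k. blinfun_apply T (x (n k)))"
    by blast
qed

text \<open>
  Closedness in the operator norm. The operators \<open>R m\<close> need different subsequences, so a diagonal
  subsequence is taken, along which the estimate for the \<open>k\<close>-th approximation holds from position \<open>k\<close> on.
  A Schreier set with minimum \<open>l\<close> lies beyond position \<open>l\<close>, where the \<open>l\<close>-th approximation is under
  control, and it has at most \<open>Suc l\<close> elements, so that an approximation with error of order
  \<open>1 / Suc l\<close> suffices.
\<close>

lemma WD_closed:
  assumes p: "1 \<le> p" and Y: "banach_space_over sY"
    and R: "\<And>m::nat. R m \<in> WD p C sX sY" and lim: "R \<longlonglongrightarrow> S" and C: "0 \<le> C"
  shows "S \<in> WD p C sX sY"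
  unfolding WD_iff
proof (intro conjI allI impI)
  interpret Y: banach_space_over sY by fact
  show "S \<in> ops sX sY"
    unfolding ops_iff
  proof (intro allI)
    fix a x
    have ap: "(\<lambda>m. blinfun_apply (R m) z) \<longlonglongrightarrow> blinfun_apply S z" for z
      using lim by (intro blinfun.tendsto tendsto_const)
    have "(\<lambda>m. sY a (blinfun_apply (R m) x)) \<longlonglongrightarrow> sY a (blinfun_apply S x)"
      by (rule bounded_linear.tendsto[OF Y.bounded_linear_scale_right ap])
    moreover have "(\<lambda>m. sY a (blinfun_apply (R m) x)) = (\<lambda>m. blinfun_apply (R m) (sX a x))"
      using R by (simp add: WD_iff ops_iff)
    ultimately show "blinfun_apply S (sX a x) = sY a (blinfun_apply S x)"
      using LIMSEQ_unique[OF ap[of "sX a x"]] by simp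
  qed
  fix \<epsilon> :: real and x assume \<epsilon>: "0 < \<epsilon>" and x: "normalized_weakly_null sX x"
  have \<epsilon>2: "0 < \<epsilon> / 2" using \<epsilon> by simp
  have "\<exists>m. norm (S - R m) \<le> \<epsilon> / 2 / Suc k" for k
  proof -
    have "0 < \<epsilon> / 2 / Suc k" using \<epsilon>2 by simp
    from LIMSEQ_D[OF lim this] obtain m where "norm (R m - S) < \<epsilon> / 2 / Suc k" by blast
    then show ?thesis by (intro exI[of _ m]) (simp add: norm_minus_commute)
  qed
  then obtain m where m: "\<And>k. norm (S - R (m k)) \<le> \<epsilon> / 2 / Suc k" by metis
  define P where "P k s \<longleftrightarrow> schreier_dominated sY p (C + \<epsilon> / 2) (\<lambda>i. blinfun_apply (R (m k)) (x (s i)))"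
    for k :: nat and s :: "nat \<Rightarrow> nat"
  interpret subseqs P
  proof
    fix k and s :: "nat \<Rightarrow> nat" assume s: "strict_mono s"
    obtain r where "strict_mono r"
      "schreier_dominated sY p (C + \<epsilon> / 2) (\<lambda>i. blinfun_apply (R (m k)) (x (s (r i))))"
      using R[of "m k"] normalized_weakly_null_subseq[OF x s] \<epsilon>2 unfolding WD_iff by blast
    then show "\<exists>r. strict_mono r \<and> P k (s \<circ> r)" by (auto simp: P_def)
  qed
  have diag: "P k (diagseq \<circ> (+) (Suc k))" for k
  proof (rule diagseq_holds)
    fix k s r assume r: "strict_mono (r :: nat \<Rightarrow> nat)" and "P k s"
    then have "schreier_dominated sY p (C + \<epsilon> / 2) (\<lambda>i. blinfun_apply (R (m k)) (x (s i)))"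
      by (simp add: P_def)
    from schreier_dominated_subseq[OF p this _ r] show "P k (s \<circ> r)"
      using C \<epsilon> by (simp add: P_def)
  qed
  \<comment> \<open>Discarding the first \<open>Suc l\<close> terms of the diagonal sequence would shift Schreier sets to the left.
    The index \<open>2 * i + 1 = Suc l + (2 * i - l)\<close> compensates for that: the position \<open>2 * i - l\<close> within
    the remaining sequence is at least \<open>i\<close> whenever \<open>l \<le> i\<close>.\<close>
  define n where "n i = diagseq (2 * i + 1)" for i
  have "strict_mono n"
    using subseq_diagseq by (simp add: n_def strict_mono_def)
  moreover have "schreier_dominated sY p (C + \<epsilon>) (\<lambda>k. blinfun_apply S (x (n k)))"
    unfolding schreier_dominated_def
  proof
    fix \<alpha> :: "nat \<Rightarrow> 'a" assume \<alpha>: "\<alpha> \<in> schreier_seqs"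
    hence fin: "finite {k. \<alpha> k \<noteq> 0}" by (simp add: schreier_seqs_iff)
    show "norm (\<Sum>k | \<alpha> k \<noteq> 0. sY (\<alpha> k) (blinfun_apply S (x (n k)))) \<le> (C + \<epsilon>) * lp_norm p \<alpha>"
    proof (cases "{k. \<alpha> k \<noteq> 0} = {}")
      case True
      have "0 \<le> (C + \<epsilon>) * lp_norm p \<alpha>"
        using C \<epsilon> by (intro mult_nonneg_nonneg lp_norm_nonneg[OF p fin]) simp
      then show ?thesis unfolding True by simp
    next
      case False
      define l where "l = Min {k. \<alpha> k \<noteq> 0}"
      have l: "\<alpha> l \<noteq> 0" "\<And>k. \<alpha> k \<noteq> 0 \<Longrightarrow> l \<le> k"
        using Min_in[OF fin False] Min_le[OF fin] by (simp_all add: l_def)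
      have "norm (\<Sum>k | \<alpha> k \<noteq> 0. sY (\<alpha> k) (blinfun_apply (R (m l)) (x (diagseq (Suc l + (2 * k - l))))))
          \<le> (C + \<epsilon> / 2) * lp_norm p \<alpha>"
      proof (rule schreier_dominated_reindex[OF p _ _ \<alpha>, where t = "\<lambda>k. 2 * k - l"
            and y = "\<lambda>i. blinfun_apply (R (m l)) (x (diagseq (Suc l + i)))"])
        show "schreier_dominated sY p (C + \<epsilon> / 2) (\<lambda>i. blinfun_apply (R (m l)) (x (diagseq (Suc l + i))))"
          using diag[of l] by (simp add: P_def)
        show "inj_on (\<lambda>k. 2 * k - l) {k. \<alpha> k \<noteq> 0}"
        proof (rule inj_onI)
          fix i k assume "i \<in> {k. \<alpha> k \<noteq> 0}" "k \<in> {k. \<alpha> k \<noteq> 0}" "2 * i - l = 2 * k - l"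
          then show "i = k" using l(2)[of i] l(2)[of k] by simp
        qed
        show "k \<le> 2 * k - l" if "\<alpha> k \<noteq> 0" for k using l(2)[OF that] by simp
      qed (use C \<epsilon> in simp)
      also have "(\<Sum>k | \<alpha> k \<noteq> 0. sY (\<alpha> k) (blinfun_apply (R (m l)) (x (diagseq (Suc l + (2 * k - l))))))
          = (\<Sum>k | \<alpha> k \<noteq> 0. sY (\<alpha> k) (blinfun_apply (R (m l)) (x (n k))))"
      proof (rule sum.cong[OF refl])
        fix k assume "k \<in> {k. \<alpha> k \<noteq> 0}"
        hence "Suc l + (2 * k - l) = 2 * k + 1" using l(2)[of k] by simp
        then show "sY (\<alpha> k) (blinfun_apply (R (m l)) (x (diagseq (Suc l + (2 * k - l)))))
            = sY (\<alpha> k) (blinfun_apply (R (m l)) (x (n k)))"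
          by (simp only: n_def)
      qed
      finally have 1: "norm (\<Sum>k | \<alpha> k \<noteq> 0. sY (\<alpha> k) (blinfun_apply (R (m l)) (x (n k))))
          \<le> (C + \<epsilon> / 2) * lp_norm p \<alpha>" .
      have 2: "norm (\<Sum>k | \<alpha> k \<noteq> 0. sY (\<alpha> k) (blinfun_apply (S - R (m l)) (x (n k))))
          \<le> \<epsilon> / 2 * lp_norm p \<alpha>"
      proof (rule Y.norm_schreier_sum_le[OF p \<alpha> l(1)])
        fix k
        have "norm (blinfun_apply (S - R (m l)) (x (n k))) \<le> norm (S - R (m l))"
          using norm_blinfun[of "S - R (m l)" "x (n k)"] x by (simp add: normalized_weakly_null_def)
        with m[of l] show "norm (blinfun_apply (S - R (m l)) (x (n k))) \<le> \<epsilon> / 2 / Suc l" by linarith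
      qed (use \<epsilon> in simp)
      have "(\<Sum>k | \<alpha> k \<noteq> 0. sY (\<alpha> k) (blinfun_apply S (x (n k))))
          = (\<Sum>k | \<alpha> k \<noteq> 0. sY (\<alpha> k) (blinfun_apply (R (m l)) (x (n k))))
            + (\<Sum>k | \<alpha> k \<noteq> 0. sY (\<alpha> k) (blinfun_apply (S - R (m l)) (x (n k))))"
        by (simp add: blinfun.diff_left flip: sum.distrib Y.scale_right_distrib)
      also have "norm \<dots> \<le> (C + \<epsilon> / 2) * lp_norm p \<alpha> + \<epsilon> / 2 * lp_norm p \<alpha>"
        by (rule norm_triangle_le[OF add_mono[OF 1 2]])
      also have "\<dots> = (C + \<epsilon>) * lp_norm p \<alpha>" by (simp add: field_simps)
      finally show ?thesis .
    qed
  qed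
  ultimately show "\<exists>n. strict_mono n \<and> schreier_dominated sY p (C + \<epsilon>) (\<lambda>k. blinfun_apply S (x (n k)))"
    by blast
qed

section \<open>The constant and the ideal norm\<close>

lemma WD_inf_iff: "T \<in> WD_inf p sX sY \<longleftrightarrow> (\<exists>C\<ge>0. T \<in> WD p C sX sY)"
  by (auto simp: WD_inf_def)

lemma WD_const_nonneg:
  assumes "T \<in> WD_inf p sX sY"
  shows "0 \<le> WD_const p sX sY T"
  unfolding WD_const_def using assms by (intro cInf_greatest) (auto simp: WD_inf_iff)

lemma WD_const_le:
  assumes "T \<in> WD p C sX sY" "0 \<le> C"
  shows "WD_const p sX sY T \<le> C"
  unfolding WD_const_def using assms by (intro cInf_lower bdd_belowI[of _ 0]) auto

text \<open>
  The infimum is a minimum because the definition of the class leaves room for an arbitrary \<open>\<epsilon>\<close>.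
\<close>

lemma WD_const_attained:
  assumes p: "1 \<le> p" and T: "T \<in> WD_inf p sX sY"
  shows "T \<in> WD p (WD_const p sX sY T) sX sY"
  unfolding WD_iff
proof (intro conjI allI impI)
  show "T \<in> ops sX sY" using T by (auto simp: WD_inf_iff WD_iff)
  fix \<epsilon> :: real and x assume \<epsilon>: "0 < \<epsilon>" and x: "normalized_weakly_null sX x"
  have "WD_const p sX sY T < WD_const p sX sY T + \<epsilon> / 2" using \<epsilon> by simp
  then obtain C where C: "C < WD_const p sX sY T + \<epsilon> / 2" "0 \<le> C" "T \<in> WD p C sX sY"
    using cInf_lessD[of "{C. 0 \<le> C \<and> T \<in> WD p C sX sY}"] T
    unfolding WD_const_def WD_inf_iff by blast
  have "0 < \<epsilon> / 2" using \<epsilon> by simp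
  then obtain n where n: "strict_mono n"
    "schreier_dominated sY p (C + \<epsilon> / 2) (\<lambda>k. blinfun_apply T (x (n k)))"
    using C(3) x unfolding WD_iff by blast
  from n(2) have "schreier_dominated sY p (WD_const p sX sY T + \<epsilon>) (\<lambda>k. blinfun_apply T (x (n k)))"
    by (rule schreier_dominated_mono[OF p]) (use C(1) in simp)
  with n(1) show "\<exists>n. strict_mono n \<and>
      schreier_dominated sY p (WD_const p sX sY T + \<epsilon>) (\<lambda>k. blinfun_apply T (x (n k)))"
    by blast
qed

lemma norm_rank_one:
  assumes Y: "banach_space_over sY"
  shows "norm (rank_one sY f y) = norm f * norm y"
proof (rule antisym)
  interpret Y: banach_space_over sY by fact
  show "norm (rank_one sY f y) \<le> norm f * norm y"
  proof (rule norm_blinfun_bound)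
    show "norm (blinfun_apply (rank_one sY f y) x) \<le> norm f * norm y * norm x" for x
      using mult_right_mono[OF norm_blinfun[of f x] norm_ge_zero[of y]]
      by (simp add: Y.rank_one_apply Y.norm_scale mult_ac)
  qed simp
  show "norm f * norm y \<le> norm (rank_one sY f y)"
  proof (cases "y = 0")
    case False
    have "norm f \<le> norm (rank_one sY f y) / norm y"
    proof (rule norm_blinfun_bound)
      show "norm (blinfun_apply f x) \<le> norm (rank_one sY f y) / norm y * norm x" for x
        using norm_blinfun[of "rank_one sY f y" x] False
        by (simp add: Y.rank_one_apply Y.norm_scale field_simps)
    qed simp
    then show ?thesis using False by (simp add: field_simps)
  qed simp
qed

lemma rank_one_finite_rank:
  assumes Y: "banach_space_over sY" and f: "f \<in> dual sX"
  shows "rank_one sY f y \<in> ops sX sY" "finite_rank sY (rank_one sY f y)"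
proof -
  interpret Y: banach_space_over sY by fact
  show "rank_one sY f y \<in> ops sX sY"
    using f by (simp add: dual_def ops_iff Y.rank_one_apply)
  have "blinfun_apply (rank_one sY f y) x \<in> Y.span {y}" for x
    unfolding Y.rank_one_apply by (intro Y.span_scale Y.span_base) simp
  then show "finite_rank sY (rank_one sY f y)"
    unfolding finite_rank_def by (intro exI[of _ "{y}"]) auto
qed

lemma WD_inf_subspace:
  assumes p: "1 \<le> p" and X: "banach_space_over sX" and Y: "banach_space_over sY"
  shows "module.subspace (scale_op sY) (WD_inf p sX sY)"
proof -
  interpret X: banach_space_over sX by fact
  interpret Y: banach_space_over sY by fact
  interpret L: module "scale_op sY :: _ \<Rightarrow> ('b \<Rightarrow>\<^sub>L 'c) \<Rightarrow> _" by (rule Y.module_scale_op)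
  show ?thesis
    unfolding L.subspace_def
  proof (intro conjI ballI allI)
    have "finite_rank sY (0 :: 'b \<Rightarrow>\<^sub>L 'c)" by (auto simp: finite_rank_def intro!: exI[of _ "{}"])
    moreover have "0 \<in> ops sX sY" by (simp add: ops_iff)
    ultimately show "0 \<in> WD_inf p sX sY"
      using finite_rank_WD[OF p X Y] by (auto simp: WD_inf_iff)
    show "S + T \<in> WD_inf p sX sY" if S: "S \<in> WD_inf p sX sY" and T: "T \<in> WD_inf p sX sY" for S T
    proof -
      obtain C where C: "0 \<le> C" "S \<in> WD p C sX sY" using S unfolding WD_inf_iff by blast
      obtain D where D: "0 \<le> D" "T \<in> WD p D sX sY" using T unfolding WD_inf_iff by blast
      show ?thesis
        unfolding WD_inf_iff using WD_add[OF p Y C(2) D(2) C(1)] C(1) D(1) by (intro exI[of _ "C + D"]) simp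
    qed
    show "scale_op sY a T \<in> WD_inf p sX sY" if T: "T \<in> WD_inf p sX sY" for a T
    proof -
      obtain C where C: "0 \<le> C" "T \<in> WD p C sX sY" using T by (auto simp: WD_inf_iff)
      \<comment> \<open>Multiplication by a scalar is composition with an operator on \<open>Y\<close>.\<close>
      have 1: "id_blinfun \<in> ops sX sX" by (simp add: ops_iff)
      have 2: "scale_op sY a id_blinfun \<in> ops sY sY"
        by (simp add: ops_iff Y.scale_op_apply mult.commute)
      have eq: "scale_op sY a T = scale_op sY a id_blinfun o\<^sub>L T o\<^sub>L id_blinfun"
        by (rule blinfun_eqI) (simp add: Y.scale_op_apply)
      have "0 \<le> norm (scale_op sY a (id_blinfun :: 'c \<Rightarrow>\<^sub>L 'c)) * C * norm (id_blinfun :: 'b \<Rightarrow>\<^sub>L 'b)"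
        using C(1) by simp
      then have "scale_op sY a id_blinfun o\<^sub>L T o\<^sub>L id_blinfun \<in> WD_inf p sX sY"
        unfolding WD_inf_iff using WD_compose[OF p X Y C(2,1) 1 2] by blast
      then show ?thesis by (simp only: eq)
    qed
  qed
qed

lemma WD_inf_diff:
  assumes p: "1 \<le> p" and X: "banach_space_over sX" and Y: "banach_space_over sY"
    and S: "S \<in> WD_inf p sX sY" and T: "T \<in> WD_inf p sX sY"
  shows "S - T \<in> WD_inf p sX sY"
proof -
  interpret Y: banach_space_over sY by fact
  interpret L: module "scale_op sY :: _ \<Rightarrow> ('b \<Rightarrow>\<^sub>L 'c) \<Rightarrow> _" by (rule Y.module_scale_op)
  show ?thesis by (rule L.subspace_diff[OF WD_inf_subspace[OF p X Y] S T])
qed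

lemma WD_const_add:
  assumes p: "1 \<le> p" and Y: "banach_space_over sY"
    and S: "S \<in> WD_inf p sX sY" and T: "T \<in> WD_inf p sX sY"
  shows "WD_const p sX sY (S + T) \<le> WD_const p sX sY S + WD_const p sX sY T"
  by (intro WD_const_le WD_add p Y WD_const_attained S T add_nonneg_nonneg WD_const_nonneg)

text \<open>
  A Cauchy sequence for \<open>WD_norm\<close> is Cauchy in the operator norm and has a limit \<open>T\<close> there. By the
  closedness of the class with constant \<open>\<epsilon>\<close>, the smallness of the constants of \<open>\<sigma> n - \<sigma> m\<close> is inherited
  by \<open>\<sigma> n - T\<close> in the limit over \<open>m\<close>.
\<close>

lemma WD_norm_complete:
  assumes p: "1 \<le> p" and X: "banach_space_over sX" and Y: "banach_space_over sY"
  shows "complete_wrt (WD_inf p sX sY) (WD_norm p sX (sY :: _ \<Rightarrow> _ \<Rightarrow> 'y::banach))"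
  unfolding complete_wrt_def
proof (intro allI impI)
  fix \<sigma> :: "nat \<Rightarrow> _"
  assume \<sigma>: "\<forall>n. \<sigma> n \<in> WD_inf p sX sY"
    and "\<forall>\<epsilon>>0. \<exists>N. \<forall>m\<ge>N. \<forall>n\<ge>N. WD_norm p sX sY (\<sigma> m - \<sigma> n) < \<epsilon>"
  hence cauchy: "\<exists>N. \<forall>m\<ge>N. \<forall>n\<ge>N. WD_norm p sX sY (\<sigma> m - \<sigma> n) < \<epsilon>" if "0 < \<epsilon>" for \<epsilon>
    using that by blast
  have diff: "\<sigma> m - \<sigma> n \<in> WD_inf p sX sY" for m n
    using WD_inf_diff[OF p X Y] \<sigma> by blast
  have "Cauchy \<sigma>"
  proof (rule CauchyI)
    fix e :: real assume "0 < e"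
    then obtain N where N: "\<forall>m\<ge>N. \<forall>n\<ge>N. WD_norm p sX sY (\<sigma> m - \<sigma> n) < e" using cauchy by blast
    have "norm (\<sigma> m - \<sigma> n) \<le> WD_norm p sX sY (\<sigma> m - \<sigma> n)" for m n
      using WD_const_nonneg[OF diff] by (simp add: WD_norm_def)
    with N show "\<exists>N. \<forall>m\<ge>N. \<forall>n\<ge>N. norm (\<sigma> m - \<sigma> n) < e" by (meson le_less_trans)
  qed
  then obtain T where T: "\<sigma> \<longlonglongrightarrow> T" using Cauchy_convergent convergent_def by blast
  have tail: "\<exists>N. \<forall>n\<ge>N. \<sigma> n - T \<in> WD p \<epsilon> sX sY" if \<epsilon>: "0 < \<epsilon>" for \<epsilon>
  proof -
    obtain N where N: "\<forall>m\<ge>N. \<forall>n\<ge>N. WD_norm p sX sY (\<sigma> m - \<sigma> n) < \<epsilon>" using cauchy[OF \<epsilon>] by blast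
    have "\<sigma> n - T \<in> WD p \<epsilon> sX sY" if n: "N \<le> n" for n
    proof (rule WD_closed[OF p Y])
      fix m
      have "norm (\<sigma> n - \<sigma> (m + N)) + WD_const p sX sY (\<sigma> n - \<sigma> (m + N)) < \<epsilon>"
        using N n by (simp add: WD_norm_def)
      hence "WD_const p sX sY (\<sigma> n - \<sigma> (m + N)) \<le> \<epsilon>"
        using norm_ge_zero[of "\<sigma> n - \<sigma> (m + N)"] by linarith
      from WD_mono[OF p WD_const_attained[OF p diff] this]
      show "\<sigma> n - \<sigma> (m + N) \<in> WD p \<epsilon> sX sY" .
      show "(\<lambda>m. \<sigma> n - \<sigma> (m + N)) \<longlonglongrightarrow> \<sigma> n - T"
        by (intro tendsto_diff tendsto_const LIMSEQ_ignore_initial_segment T)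
    qed (use \<epsilon> in simp)
    then show ?thesis by blast
  qed
  obtain N where "\<sigma> N - T \<in> WD p 1 sX sY" using tail[of 1] by auto
  hence "\<sigma> N - T \<in> WD_inf p sX sY" unfolding WD_inf_iff by (intro exI[of _ 1]) simp
  from WD_inf_diff[OF p X Y _ this, of "\<sigma> N"] \<sigma> have "T \<in> WD_inf p sX sY" by simp
  moreover have "(\<lambda>n. WD_norm p sX sY (\<sigma> n - T)) \<longlonglongrightarrow> 0"
  proof (rule LIMSEQ_I)
    fix e :: real assume e: "0 < e"
    obtain N where N: "\<forall>n\<ge>N. \<sigma> n - T \<in> WD p (e / 2) sX sY" using tail[of "e / 2"] e by auto
    obtain M where M: "\<forall>n\<ge>M. norm (\<sigma> n - T) < e / 2" using LIMSEQ_D[OF T, of "e / 2"] e by auto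
    have "norm (WD_norm p sX sY (\<sigma> n - T) - 0) < e" if n: "n \<ge> max M N" for n
    proof -
      have mem: "\<sigma> n - T \<in> WD p (e / 2) sX sY" using N n by simp
      have e2: "0 \<le> e / 2" using e by simp
      have "\<sigma> n - T \<in> WD_inf p sX sY" unfolding WD_inf_iff using mem e2 by blast
      note WD_const_le[OF mem e2] WD_const_nonneg[OF this]
      moreover have "norm (\<sigma> n - T) < e / 2" using M n by simp
      ultimately show ?thesis by (simp add: WD_norm_def)
    qed
    then show "\<exists>M. \<forall>n\<ge>M. norm (WD_norm p sX sY (\<sigma> n - T) - 0) < e" by blast
  qed
  ultimately show "\<exists>T\<in>WD_inf p sX sY. (\<lambda>n. WD_norm p sX sY (\<sigma> n - T)) \<longlonglongrightarrow> 0" by blast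
qed

theorem proposition2p17:
  fixes p :: ereal
    and sW :: "'k::real_normed_field \<Rightarrow> 'w::banach \<Rightarrow> 'w"
    and sX :: "'k \<Rightarrow> 'x::banach \<Rightarrow> 'x"
    and sY :: "'k \<Rightarrow> 'y::banach \<Rightarrow> 'y"
    and sZ :: "'k \<Rightarrow> 'z::banach \<Rightarrow> 'z"
  assumes "1 \<le> p"
    and "banach_space_over sW" and "banach_space_over sX"
    and "banach_space_over sY" and "banach_space_over sZ"
  shows "banach_ideal sW sX sY sZ
           (WD_inf p sX sY) (WD_inf p sW sZ) (WD_norm p sX sY) (WD_norm p sW sZ)"
proof -
  note p = assms(1) and X = assms(3) and Y = assms(4)
  have compose: "B o\<^sub>L T o\<^sub>L A \<in> WD p (norm B * WD_const p sX sY T * norm A) sW sZ"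
    and const_nonneg: "0 \<le> norm B * WD_const p sX sY T * norm A"
    if "T \<in> WD_inf p sX sY" "A \<in> ops sW sX" "B \<in> ops sY sZ" for T A B
    using that by (auto intro!: WD_compose[OF p X Y] WD_const_attained[OF p] WD_const_nonneg
        mult_nonneg_nonneg)
  have "operator_ideal sW sX sY sZ (WD_inf p sX sY) (WD_inf p sW sZ)"
    unfolding operator_ideal_def
  proof (intro conjI ballI impI)
    show "WD_inf p sX sY \<subseteq> ops sX sY" by (auto simp: WD_inf_iff WD_iff)
    show "module.subspace (scale_op sY) (WD_inf p sX sY)" by (rule WD_inf_subspace[OF p X Y])
    show "T \<in> WD_inf p sX sY" if "T \<in> ops sX sY" "finite_rank sY T" for T
      using finite_rank_WD[OF p X Y that] by (auto simp: WD_inf_iff)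
    show "B o\<^sub>L T o\<^sub>L A \<in> WD_inf p sW sZ"
      if "T \<in> WD_inf p sX sY" "A \<in> ops sW sX" "B \<in> ops sY sZ" for T A B
      unfolding WD_inf_iff using compose[OF that] const_nonneg[OF that] by blast
  qed
  moreover have "ideal_norm sW sX sY sZ (WD_inf p sX sY) (WD_norm p sX sY) (WD_norm p sW sZ)"
    unfolding ideal_norm_def
  proof (intro conjI ballI allI)
    show "0 \<le> WD_norm p sX sY T" if "T \<in> WD_inf p sX sY" for T
      using WD_const_nonneg[OF that] by (simp add: WD_norm_def)
    show "WD_norm p sX sY (rank_one sY f y) = norm f * norm y" if f: "f \<in> dual sX" for f y
    proof -
      have "rank_one sY f y \<in> WD p 0 sX sY"
        by (rule finite_rank_WD[OF p X Y rank_one_finite_rank[OF Y f]])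
      hence "WD_const p sX sY (rank_one sY f y) = 0"
        by (intro antisym WD_const_le WD_const_nonneg) (auto simp: WD_inf_iff)
      then show ?thesis by (simp add: WD_norm_def norm_rank_one[OF Y])
    qed
    show "WD_norm p sX sY (S + T) \<le> WD_norm p sX sY S + WD_norm p sX sY T"
      if "S \<in> WD_inf p sX sY" "T \<in> WD_inf p sX sY" for S T
      using WD_const_add[OF p Y that] norm_triangle_ineq[of S T] by (simp add: WD_norm_def)
    show "WD_norm p sW sZ (B o\<^sub>L T o\<^sub>L A) \<le> norm B * WD_norm p sX sY T * norm A"
      if "T \<in> WD_inf p sX sY" "A \<in> ops sW sX" "B \<in> ops sY sZ" for T A B
    proof -
      have "norm (B o\<^sub>L T o\<^sub>L A) \<le> norm (B o\<^sub>L T) * norm A" by (rule norm_blinfun_compose)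
      also have "\<dots> \<le> norm B * norm T * norm A"
        by (intro mult_right_mono norm_blinfun_compose) simp
      finally have "norm (B o\<^sub>L T o\<^sub>L A) \<le> norm B * norm T * norm A" .
      moreover have "WD_const p sW sZ (B o\<^sub>L T o\<^sub>L A) \<le> norm B * WD_const p sX sY T * norm A"
        by (rule WD_const_le[OF compose[OF that] const_nonneg[OF that]])
      ultimately show ?thesis by (simp add: WD_norm_def algebra_simps)
    qed
  qed
  moreover have "complete_wrt (WD_inf p sX sY) (WD_norm p sX sY)"
    by (rule WD_norm_complete[OF p X Y])
  ultimately show ?thesis by (simp add: banach_ideal_def)
qed

end
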